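(* Let $M$ be chosen from the Haar probability measure of $U(n,\mathbb{C})$, let $j\ge 1$ be an integer, and let $W(M)=\frac{1}{\sqrt{2j}}\left[\mathrm{Tr}(M^j)+\overline{\mathrm{Tr}(M^j)}\right]$. Then $$\left|\mathbb{P}(W\le x_0)-\frac{1}{\sqrt{2\pi}}\int_{-\infty}^{x_0}e^{-x^2/2}\,dx\right| = O(j/n),$$ that is, there is an absolute constant $C>0$ such that for all integers $n\ge 1$, $j\ge 1$ and all real $x_0$ the left-hand side is at most $Cj/n$.
   Context: $U(n,\mathbb{C})$ is the group of $n\times n$ unitary complex matrices. The integer $j$ is allowed to grow with $n$; the implied constant does not depend on $j$, $n$ or $x_0$. *)

theory Defs
  imports "HOL-Probability.Probability" "Jordan_Normal_Form.Schur_Decomposition"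
begin

definition unitary_group :: "nat \<Rightarrow> complex mat set" where
  "unitary_group n = {A \<in> carrier_mat n n. A * mat_adjoint A = 1\<^sub>m n \<and> mat_adjoint A * A = 1\<^sub>m n}"

definition mat_trace :: "complex mat \<Rightarrow> complex" where
  "mat_trace A = (\<Sum>i<dim_row A. A $$ (i, i))"

(* A matrix of dimension n as a point of the space of functions nat * nat => complex (with the
   product topology), extended by 0 outside the index range.  This identifies the n by n matrices,
   with their usual topology, with a closed subspace. *)
definition mat_entries :: "nat \<Rightarrow> complex mat \<Rightarrow> nat \<times> nat \<Rightarrow> complex" where
  "mat_entries n A = (\<lambda>(i, k). if i < n \<and> k < n then A $$ (i, k) else 0)"

(* The type of matrices carries no topology in the library.  The Borel sets of U(n) are obtained by
   pulling back the Borel sets of the function space along the embedding above; that is the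
   Borel sigma-algebra of the subspace topology on U(n). *)
definition unitary_borel :: "nat \<Rightarrow> complex mat measure" where
  "unitary_borel n = vimage_algebra (unitary_group n) (mat_entries n) borel"

definition haar_prob_measure :: "nat \<Rightarrow> complex mat measure \<Rightarrow> bool" where
  "haar_prob_measure n \<mu> \<longleftrightarrow>
     prob_space \<mu> \<and> space \<mu> = unitary_group n \<and> sets \<mu> = sets (unitary_borel n) \<and>
     (\<forall>A \<in> unitary_group n. \<forall>S \<in> sets \<mu>. emeasure \<mu> ((\<lambda>B. A * B) ` S) = emeasure \<mu> S)"

(* The complex number inside Re is real, since it is a real multiple of z + cnj z; Re only changes
   its type. *)
definition trace_power_stat :: "nat \<Rightarrow> complex mat \<Rightarrow> real" where
  "trace_power_stat j M =
     Re (1 / complex_of_real (sqrt (2 * real j)) *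
         (mat_trace (M ^\<^sub>m j) + cnj (mat_trace (M ^\<^sub>m j))))"

end

theory Submission
  imports Defs
begin

text \<open>
  The proof is Stein's method, with the identities it needs supplied by integration by parts over
  the unitary group.  Write \<open>p\<^sub>j = Tr(M^j)\<close> and let \<open>S\<^sub>j\<close> be the sum of \<open>p\<^sub>l p\<^sub>m\<close>
  over \<open>l, m \<ge> 1\<close> with \<open>l + m = j\<close>.

  A continuously differentiable \<open>f\<close> with \<open>f' - w f = h - N(h)\<close>, where \<open>N(h)\<close> is the normal mean of
  \<open>h\<close>, turns the distance between the law of \<open>W\<close> and the normal law into the size of
  \<open>E[f'(W) - W f(W)]\<close>.  For every \<open>h\<close> with values between 0 and 1 the solution and its derivative
  are bounded by absolute constants, so that \<open>h\<close> may approach the indicator of a half-line at no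
  cost (\<open>stein_kolmogorov_bound\<close>).

  Left invariance of Haar measure says that the derivative of a function along a one-parameter
  subgroup has mean zero.  Applied to the entries of \<open>M^j\<close> times a test function \<open>F\<close>, and summed
  over the directions of all matrix units \<open>E\<^sub>a\<^sub>b\<close>, it gives the Schwinger-Dyson equation
  \<open>E[(n p\<^sub>j + S\<^sub>j) F] + E[\<Sum> (M^j)\<^sub>a\<^sub>b D\<^sub>a\<^sub>b F] = 0\<close> (\<open>schwinger_dyson\<close>), where \<open>D\<^sub>a\<^sub>b\<close> is the
  derivative in the direction \<open>E\<^sub>a\<^sub>b\<close>.  With \<open>F = f(W)\<close> it becomes
  \<open>n E[f'(W) - W f(W)] = E[f'(W) Re p\<^sub>2\<^sub>j] + 2 E[f(W) Re S\<^sub>j] / sqrt(2j)\<close>, so it remains to see that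
  \<open>E|p\<^sub>2\<^sub>j|\<close> is \<open>O(j)\<close> and that \<open>E|S\<^sub>j|\<close> is \<open>O(j^(3/2))\<close>.

  Both second moments follow from a spectral bound.  On polynomials of degree \<open>k\<close> in the entries of
  \<open>M\<close> the Laplacian is \<open>nk\<close> plus the sum \<open>K\<close> of all exchanges of two row indices.  There are
  \<open>k(k-1)\<close> of them, so the iterates of \<open>K\<close> grow at most like powers of \<open>k(k-1)\<close> in the supremum
  norm; since \<open>K\<close> is symmetric in \<open>L\<^sup>2\<close>, log-convexity of the norms of its iterates makes \<open>k(k-1)\<close> a
  bound for its \<open>L\<^sup>2\<close> operator norm (\<open>shifted_laplacian_norm_bound\<close>).  As \<open>K p\<^sub>j = j S\<^sub>j\<close>, this reads
  \<open>E|S\<^sub>j|\<^sup>2 \<le> (j-1)\<^sup>2 E|p\<^sub>j|\<^sup>2\<close>.  Inserting it into the Schwinger-Dyson equation with \<open>F\<close> the conjugate of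
  \<open>p\<^sub>j\<close>, that is \<open>n E|p\<^sub>j|\<^sup>2 + E[S\<^sub>j cnj p\<^sub>j] = jn\<close>, gives \<open>E|p\<^sub>j|\<^sup>2 \<le> 2j\<close> as soon as \<open>2j \<le> n\<close>.  If \<open>4j > n\<close>
  the claimed bound exceeds 1 and is trivial.
\<close>

section \<open>Stein's equation for the normal law\<close>

lemma continuous_std_normal_density: "continuous_on A std_normal_density"
  unfolding std_normal_density_def by (intro continuous_intros) auto

lemma std_normal_density_has_derivative:
  "(std_normal_density has_real_derivative - x * std_normal_density x) (at x)"
  unfolding std_normal_density_def
  by (auto intro!: derivative_eq_intros simp: field_simps)

lemma integrable_std_normal_density: "integrable lborel std_normal_density"
  using integrable_std_normal_moment[of 0] by simp

lemma integral_std_normal_density: "(\<integral>x. std_normal_density x \<partial>lborel) = 1"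
  using integral_std_normal_moment_even[of 0] by simp

text \<open>Both tails of the normal law are expressed through the upper one: by symmetry the distribution
  function at \<open>t\<close> is \<open>normal_tail (- t)\<close>.\<close>
definition normal_tail :: "real \<Rightarrow> real" where
  "normal_tail w = (\<integral>x. indicator {w..} x * std_normal_density x \<partial>lborel)"

lemma integrable_indicator_density:
  assumes "A \<in> sets borel"
  shows "integrable lborel (\<lambda>x. indicator A x * std_normal_density x)"
  using integrable_real_mult_indicator[OF _ integrable_std_normal_density, of A] assms
  by (simp add: mult.commute)

lemma normal_tail_le_1: "normal_tail w \<le> 1"
proof -
  have "normal_tail w \<le> (\<integral>x. std_normal_density x \<partial>lborel)"
    unfolding normal_tail_def
    by (intro integral_mono integrable_std_normal_density integrable_indicator_density)
      (auto simp: indicator_def)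
  then show ?thesis by (simp add: integral_std_normal_density)
qed

lemma normal_lower_tail:
  "(\<integral>x. indicator {..w} x * std_normal_density x \<partial>lborel) = normal_tail (- w)"
proof -
  have "(\<integral>x. indicator {..w} x * std_normal_density x \<partial>lborel) =
      (\<integral>x. indicator {..w} (- x) * std_normal_density (- x) \<partial>lborel)"
    by (subst lborel_integral_real_affine[where c = "-1" and t = 0]) auto
  also have "\<dots> = normal_tail (- w)"
    unfolding normal_tail_def
    by (intro Bochner_Integration.integral_cong) (auto simp: indicator_def std_normal_density_def)
  finally show ?thesis .
qed

text \<open>On the half-line to the right of \<open>w\<close> the factor \<open>w\<close> is at most the integration variable \<open>x\<close>, and
  \<open>x * std_normal_density x\<close> has the primitive \<open>- std_normal_density x\<close>.\<close>
lemma mills_inequality: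
  assumes "w \<ge> 0"
  shows "w * normal_tail w \<le> std_normal_density w"
proof -
  define F where "F = (\<lambda>x. - std_normal_density x)"
  have lim: "(F \<longlongrightarrow> 0) at_top"
    unfolding F_def std_normal_density_def by real_asymp
  have nn: "(\<integral>\<^sup>+x. ennreal (x * std_normal_density x) * indicator {w..} x \<partial>lborel)
      = 0 - F w"
  proof (rule nn_integral_FTC_atLeast)
    show "(\<lambda>x. x * std_normal_density x) \<in> borel_measurable borel" by measurable
    show "\<And>x. w \<le> x \<Longrightarrow> (F has_real_derivative x * std_normal_density x) (at x)"
      unfolding F_def using DERIV_minus[OF std_normal_density_has_derivative] by simp
  qed (use assms lim in auto)
  have "ennreal (w * normal_tail w)
      = (\<integral>\<^sup>+x. ennreal (w * (indicator {w..} x * std_normal_density x)) \<partial>lborel)"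
    unfolding normal_tail_def
    using assms integrable_indicator_density[of "{w..}"]
    by (subst nn_integral_eq_integral) auto
  also have "\<dots> \<le> (\<integral>\<^sup>+x. ennreal (x * std_normal_density x) * indicator {w..} x \<partial>lborel)"
    by (intro nn_integral_mono) (auto simp: indicator_def intro!: ennreal_leI mult_right_mono)
  also have "\<dots> = ennreal (std_normal_density w)" using nn by (simp add: F_def)
  finally show ?thesis by (simp add: ennreal_le_iff)
qed

lemma integrable_density_mult:
  assumes [measurable]: "h \<in> borel_measurable borel" and h: "\<And>x. 0 \<le> h x" "\<And>x. h x \<le> 1"
  shows "integrable lborel (\<lambda>x. std_normal_density x * h x)"
  by (rule Bochner_Integration.integrable_bound[OF integrable_std_normal_density])
    (use h in \<open>auto simp: abs_mult mult_left_le\<close>)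

lemma normal_mean_bounds:
  assumes "h \<in> borel_measurable borel" and h: "\<And>x. 0 \<le> h x" "\<And>x. h x \<le> 1"
  shows "0 \<le> (\<integral>x. std_normal_density x * h x \<partial>lborel)"
    and "(\<integral>x. std_normal_density x * h x \<partial>lborel) \<le> 1"
proof -
  show "0 \<le> (\<integral>x. std_normal_density x * h x \<partial>lborel)"
    using h by (intro integral_nonneg_AE) auto
  have "(\<integral>x. std_normal_density x * h x \<partial>lborel) \<le> (\<integral>x. std_normal_density x \<partial>lborel)"
    using h by (intro integral_mono integrable_density_mult assms integrable_std_normal_density)
      (auto simp: mult_left_le)
  then show "(\<integral>x. std_normal_density x * h x \<partial>lborel) \<le> 1"
    by (simp add: integral_std_normal_density)
qed

text \<open>The first-order linear equation has the solution \<open>g / std_normal_density\<close>, where \<open>g w\<close> integrates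
  \<open>std_normal_density * (h - c)\<close> up to \<open>w\<close> and \<open>c\<close> is the normal mean of \<open>h\<close>.  Because the integral over the whole line vanishes, \<open>g\<close>
  is dominated by the normal tail on either side, and Mills' inequality controls \<open>w * f w\<close>.  For
  \<open>\<bar>w\<bar> \<ge> 1\<close> that bounds \<open>f\<close> too; for \<open>\<bar>w\<bar> \<le> 1\<close> the density is bounded below, whence the constant 6.\<close>
lemma stein_solution:
  fixes h :: "real \<Rightarrow> real"
  assumes cont: "continuous_on UNIV h" and h: "\<And>x. 0 \<le> h x" "\<And>x. h x \<le> 1"
  obtains f where
    "\<And>w. (f has_real_derivative
        w * f w + h w - (\<integral>x. std_normal_density x * h x \<partial>lborel)) (at w)"
    "\<And>w. \<bar>f w\<bar> \<le> 6" "\<And>w. \<bar>w * f w\<bar> \<le> 1"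
proof -
  define c where "c = (\<integral>x. std_normal_density x * h x \<partial>lborel)"
  define k where "k = (\<lambda>x. std_normal_density x * (h x - c))"
  have [measurable]: "h \<in> borel_measurable borel"
    using cont by (rule borel_measurable_continuous_onI)
  have int_h: "integrable lborel (\<lambda>x. std_normal_density x * h x)"
    using h by (intro integrable_density_mult) auto
  have c01: "0 \<le> c" "c \<le> 1"
    unfolding c_def using h by (intro normal_mean_bounds; simp)+
  have hc: "\<bar>h x - c\<bar> \<le> 1" for x using h[of x] c01 by linarith
  have k_le: "\<bar>k x\<bar> \<le> std_normal_density x" for x
    unfolding k_def abs_mult using hc[of x] by (simp add: mult_left_le)
  have contk: "continuous_on A k" for A
    unfolding k_def
    by (intro continuous_intros continuous_std_normal_density continuous_on_subset[OF cont]) auto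
  have [measurable]: "k \<in> borel_measurable borel" unfolding k_def by measurable
  have int_k: "integrable lborel k"
    by (rule Bochner_Integration.integrable_bound[OF integrable_std_normal_density])
      (use k_le in auto)
  have int_k0: "(\<integral>x. k x \<partial>lborel) = 0"
    unfolding k_def right_diff_distrib
    using int_h integrable_std_normal_density
    by (simp add: integral_std_normal_density c_def)
  have int_ik: "integrable lborel (\<lambda>x. indicator A x * k x)" if "A \<in> sets borel" for A
    using integrable_real_mult_indicator[OF _ int_k, of A] that by (simp add: mult.commute)
  define g where "g = (\<lambda>w. \<integral>x. indicator {..w} x * k x \<partial>lborel)"
  have g_lower: "\<bar>g w\<bar> \<le> normal_tail (- w)" for w
  proof -
    have "\<bar>g w\<bar> \<le> (\<integral>x. indicator {..w} x * std_normal_density x \<partial>lborel)"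
      unfolding g_def
      by (rule order_trans[OF integral_abs_bound], intro integral_mono integrable_abs int_ik
          integrable_indicator_density) (use k_le in \<open>auto simp: indicator_def\<close>)
    then show ?thesis by (simp add: normal_lower_tail)
  qed
  have g_upper: "\<bar>g w\<bar> \<le> normal_tail w" for w
  proof -
    have "g w + (\<integral>x. indicator {w<..} x * k x \<partial>lborel) = (\<integral>x. k x \<partial>lborel)"
      unfolding g_def
      by (subst Bochner_Integration.integral_add[symmetric, OF int_ik int_ik])
        (auto intro!: Bochner_Integration.integral_cong simp: indicator_def)
    then have "\<bar>g w\<bar> = \<bar>\<integral>x. indicator {w<..} x * k x \<partial>lborel\<bar>" by (simp add: int_k0)
    also have "\<dots> \<le> (\<integral>x. indicator {w..} x * std_normal_density x \<partial>lborel)"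
      by (rule order_trans[OF integral_abs_bound], intro integral_mono integrable_abs int_ik
          integrable_indicator_density) (use k_le in \<open>auto simp: indicator_def\<close>)
    finally show ?thesis by (simp add: normal_tail_def)
  qed
  have pos: "std_normal_density w > 0" for w by (simp add: normal_density_pos)
  have even: "std_normal_density (- w) = std_normal_density w" for w
    by (simp add: std_normal_density_def)
  have wg: "\<bar>w\<bar> * \<bar>g w\<bar> \<le> std_normal_density w" for w
  proof (cases "w \<ge> 0")
    case True
    then have "\<bar>w\<bar> * \<bar>g w\<bar> \<le> w * normal_tail w" using g_upper[of w] by (simp add: mult_left_mono)
    then show ?thesis using mills_inequality[OF True] by simp
  next
    case False
    then have "\<bar>w\<bar> * \<bar>g w\<bar> \<le> (- w) * normal_tail (- w)"
      using g_lower[of w] by (intro mult_mono) auto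
    also have "\<dots> \<le> std_normal_density w"
      using mills_inequality[of "- w"] False even[of w] by simp
    finally show ?thesis .
  qed
  have dg: "(g has_real_derivative k w) (at w)" for w
  proof -
    have split: "g u = g (w - 1) + integral {w - 1..u} k" if "w - 1 \<le> u" for u
    proof -
      have "g u = g (w - 1) + (\<integral>x. indicator {w - 1<..u} x * k x \<partial>lborel)"
        unfolding g_def
        by (subst Bochner_Integration.integral_add[symmetric, OF int_ik int_ik])
          (use that in \<open>auto intro!: Bochner_Integration.integral_cong simp: indicator_def\<close>)
      also have "(\<integral>x. indicator {w - 1<..u} x * k x \<partial>lborel) = (LINT x:{w - 1..u}|lborel. k x)"
        unfolding set_lebesgue_integral_def
      proof (rule integral_cong_AE)
        show "AE x in lborel. indicator {w - 1<..u} x * k x = indicator {w - 1..u} x *\<^sub>R k x"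
          using AE_lborel_singleton[of "w - 1"] by eventually_elim (auto simp: indicator_def)
      qed auto
      also have "\<dots> = integral {w - 1..u} k"
        by (rule set_borel_integral_eq_integral)
          (simp add: set_integrable_def int_ik)
      finally show ?thesis .
    qed
    have "((\<lambda>u. integral {w - 1..u} k) has_real_derivative k w) (at w within {w - 1..w + 1})"
      by (rule integral_has_real_derivative) (auto intro: contk)
    then have "((\<lambda>u. integral {w - 1..u} k) has_real_derivative k w) (at w within {w - 1<..<w + 1})"
      by (rule DERIV_subset) auto
    then have "((\<lambda>u. integral {w - 1..u} k) has_real_derivative k w) (at w)"
      by (simp add: at_within_open[of w "{w - 1<..<w + 1}"])
    then have "((\<lambda>u. g (w - 1) + integral {w - 1..u} k) has_real_derivative k w) (at w)"
      by (auto intro!: derivative_eq_intros)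
    then show ?thesis
    proof (rule has_field_derivative_transform_within_open[where S = "{w - 1<..}"])
      show "g (w - 1) + integral {w - 1..u} k = g u" if "u \<in> {w - 1<..}" for u
        using split[of u] that by simp
    qed auto
  qed
  define f where "f = (\<lambda>w. g w / std_normal_density w)"
  have deriv: "(f has_real_derivative w * f w + h w - c) (at w)" for w
  proof -
    have "(f has_real_derivative
       (k w * std_normal_density w - g w * (- w * std_normal_density w))
         / (std_normal_density w * std_normal_density w)) (at w)"
      unfolding f_def using pos[of w]
      by (intro DERIV_divide dg std_normal_density_has_derivative) auto
    also have "(k w * std_normal_density w - g w * (- w * std_normal_density w))
         / (std_normal_density w * std_normal_density w) = w * f w + h w - c"
      using pos[of w] by (simp add: f_def k_def field_simps)
    finally show ?thesis .
  qed
  have wf: "\<bar>w * f w\<bar> \<le> 1" for w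
    using wg[of w] pos[of w] by (simp add: f_def abs_mult)
  have bound: "\<bar>f w\<bar> \<le> 6" for w
  proof (cases "\<bar>w\<bar> \<ge> 1")
    case True
    have "1 * \<bar>f w\<bar> \<le> \<bar>w\<bar> * \<bar>f w\<bar>" using True by (intro mult_right_mono) auto
    with wf[of w] show ?thesis by (simp add: abs_mult)
  next
    case False
    then have "w\<^sup>2 \<le> 1" by (simp add: abs_square_le_1)
    then have "exp (w\<^sup>2 / 2) \<le> exp (1 / 2 :: real)" by simp
    also have "exp (1 / 2 :: real) \<le> 2"
    proof (rule power2_le_imp_le)
      have "(exp (1 / 2 :: real))\<^sup>2 = exp 1" by (simp add: power2_eq_square flip: exp_add)
      then show "(exp (1 / 2 :: real))\<^sup>2 \<le> 2\<^sup>2" using exp_le by simp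
    qed simp
    finally have e: "exp (w\<^sup>2 / 2) \<le> 2" .
    have "sqrt (2 * pi) \<le> 3" using pi_less_4 by (intro real_le_lsqrt) auto
    have "\<bar>f w\<bar> = \<bar>g w\<bar> * (sqrt (2 * pi) * exp (w\<^sup>2 / 2))"
      by (simp add: f_def std_normal_density_def exp_minus abs_mult field_simps)
    also have "\<dots> \<le> 1 * (3 * 2)"
      using e \<open>sqrt (2 * pi) \<le> 3\<close> g_upper[of w] normal_tail_le_1[of w]
      by (intro mult_mono) auto
    finally show ?thesis by simp
  qed
  show thesis
    using deriv bound wf unfolding c_def by (rule that)
qed

lemma normal_tail_lipschitz:
  assumes "u \<le> v"
  shows "normal_tail u \<le> normal_tail v + (v - u)"
proof -
  have "normal_tail u = normal_tail v + (\<integral>x. indicator {u..<v} x * std_normal_density x \<partial>lborel)"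
    unfolding normal_tail_def
    by (subst Bochner_Integration.integral_add[symmetric,
          OF integrable_indicator_density integrable_indicator_density])
      (use assms in \<open>auto intro!: Bochner_Integration.integral_cong simp: indicator_def\<close>)
  moreover have "(\<integral>x. indicator {u..<v} x * std_normal_density x \<partial>lborel)
      \<le> (\<integral>x. indicator {u..<v} x \<partial>lborel)"
  proof (intro integral_mono integrable_indicator_density)
    have "std_normal_density x \<le> 1 * 1" for x
      unfolding std_normal_density_def using pi_ge_two by (intro mult_mono) auto
    then show "indicator {u..<v} x * std_normal_density x \<le> indicator {u..<v} x" for x
      by (auto simp: indicator_def)
    show "integrable lborel (indicator {u..<v} :: real \<Rightarrow> real)"
      using assms by (intro integrable_real_indicator) (auto simp: emeasure_lborel_Ico)
  qed auto
  ultimately show ?thesis using assms by simp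
qed

text \<open>The indicator of a half-line has a discontinuous Stein solution derivative, so it is squeezed
  between two continuous ramps of width \<open>e\<close>.  The bound \<open>B\<close> holds uniformly in the ramp, and the
  normal law gives mass at most \<open>e\<close> to an interval of length \<open>e\<close>; letting \<open>e\<close> tend to 0 loses
  nothing.\<close>
lemma (in prob_space) stein_kolmogorov_bound:
  fixes X :: "'a \<Rightarrow> real"
  assumes X [measurable]: "random_variable borel X"
  assumes B: "\<And>f f'. (\<And>w. (f has_real_derivative f' w) (at w)) \<Longrightarrow> continuous_on UNIV f' \<Longrightarrow>
      (\<And>w. \<bar>f w\<bar> \<le> 6) \<Longrightarrow> (\<And>w. \<bar>f' w\<bar> \<le> 2) \<Longrightarrow>
      \<bar>expectation (\<lambda>\<omega>. f' (X \<omega>) - X \<omega> * f (X \<omega>))\<bar> \<le> B"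
  shows "\<bar>prob {\<omega> \<in> space M. X \<omega> \<le> t} - normal_tail (- t)\<bar> \<le> B"
proof -
  have smooth: "\<bar>expectation (\<lambda>\<omega>. h (X \<omega>)) - (\<integral>x. std_normal_density x * h x \<partial>lborel)\<bar> \<le> B"
    if cont: "continuous_on UNIV h" and h: "\<And>x. 0 \<le> h x" "\<And>x. h x \<le> 1" for h :: "real \<Rightarrow> real"
  proof -
    define c where "c = (\<integral>x. std_normal_density x * h x \<partial>lborel)"
    have [measurable]: "h \<in> borel_measurable borel"
      using cont by (rule borel_measurable_continuous_onI)
    obtain f where f: "\<And>w. (f has_real_derivative w * f w + h w - c) (at w)"
      "\<And>w. \<bar>f w\<bar> \<le> 6" "\<And>w. \<bar>w * f w\<bar> \<le> 1"
      using stein_solution[OF cont h] unfolding c_def by metis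
    have c01: "0 \<le> c" "c \<le> 1"
      unfolding c_def using h by (intro normal_mean_bounds; simp)+
    have "continuous_on UNIV f"
      using f(1) by (meson DERIV_isCont continuous_at_imp_continuous_on)
    then have "\<bar>expectation (\<lambda>\<omega>. (X \<omega> * f (X \<omega>) + h (X \<omega>) - c) - X \<omega> * f (X \<omega>))\<bar> \<le> B"
    proof (intro B f)
      show "\<bar>w * f w + h w - c\<bar> \<le> 2" for w
        using f(3)[of w] h[of w] c01 by linarith
    qed (intro continuous_intros cont)
    moreover have "integrable M (\<lambda>\<omega>. h (X \<omega>))"
      by (rule integrable_const_bound[where B = 1]) (use h in auto)
    ultimately show ?thesis by (simp add: prob_space c_def)
  qed
  define ramp where "ramp = (\<lambda>t e x. max 0 (min 1 ((t + e - x) / e)) :: real)"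
  have sandwich: "indicator {..t} x \<le> ramp t e x" "ramp t e x \<le> indicator {..t + e} x"
    if "e > 0" for t e x :: real
  proof -
    have "x \<le> t \<Longrightarrow> 1 \<le> (t + e - x) / e" "t + e < x \<Longrightarrow> (t + e - x) / e \<le> 0"
      using that by (auto simp: divide_nonpos_pos)
    then show "indicator {..t} x \<le> ramp t e x" "ramp t e x \<le> indicator {..t + e} x"
      by (auto simp: ramp_def indicator_def)
  qed
  have ramp: "continuous_on UNIV (ramp t e)" "\<And>x. 0 \<le> ramp t e x" "\<And>x. ramp t e x \<le> 1"
    if "e > 0" for t e
    using that unfolding ramp_def by (auto intro!: continuous_intros)
  have int_ramp: "integrable lborel (\<lambda>x. std_normal_density x * ramp t e x)" if "e > 0" for t e
    using ramp[OF that] by (intro integrable_density_mult borel_measurable_continuous_onI)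
  have int_ramp_X: "integrable M (\<lambda>\<omega>. ramp t e (X \<omega>))" if "e > 0" for t e
  proof (rule integrable_const_bound[where B = 1])
    show "(\<lambda>\<omega>. ramp t e (X \<omega>)) \<in> borel_measurable M"
      using borel_measurable_continuous_onI[OF ramp(1)[OF that, of t]] by simp
  qed (use ramp[OF that] in auto)
  have ramp_X: "prob {\<omega> \<in> space M. X \<omega> \<le> t} \<le> expectation (\<lambda>\<omega>. ramp t e (X \<omega>))"
    "expectation (\<lambda>\<omega>. ramp t e (X \<omega>)) \<le> prob {\<omega> \<in> space M. X \<omega> \<le> t + e}" if "e > 0" for t e
  proof -
    have P: "prob {\<omega> \<in> space M. X \<omega> \<le> s} = expectation (\<lambda>\<omega>. indicator {..s} (X \<omega>))"
      and I: "integrable M (\<lambda>\<omega>. indicator {..s} (X \<omega>) :: real)" for s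
    proof -
      have *: "(\<lambda>\<omega>. indicator {..s} (X \<omega>) :: real) = indicator (X -` {..s})"
        by (auto simp: indicator_def)
      have "X -` {..s} \<inter> space M = {\<omega> \<in> space M. X \<omega> \<le> s}" by auto
      then show "prob {\<omega> \<in> space M. X \<omega> \<le> s} = expectation (\<lambda>\<omega>. indicator {..s} (X \<omega>))"
        unfolding * by simp
      show "integrable M (\<lambda>\<omega>. indicator {..s} (X \<omega>) :: real)"
        by (rule integrable_const_bound[where B = 1]) auto
    qed
    show "prob {\<omega> \<in> space M. X \<omega> \<le> t} \<le> expectation (\<lambda>\<omega>. ramp t e (X \<omega>))"
      unfolding P using sandwich[OF that] by (intro integral_mono I int_ramp_X that)
    show "expectation (\<lambda>\<omega>. ramp t e (X \<omega>)) \<le> prob {\<omega> \<in> space M. X \<omega> \<le> t + e}"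
      unfolding P using sandwich[OF that] by (intro integral_mono I int_ramp_X that)
  qed
  have ramp_normal: "normal_tail (- t) \<le> (\<integral>x. std_normal_density x * ramp t e x \<partial>lborel)"
    "(\<integral>x. std_normal_density x * ramp t e x \<partial>lborel) \<le> normal_tail (- (t + e))" if "e > 0" for t e
    unfolding normal_lower_tail[symmetric] using sandwich[OF that]
    by (intro integral_mono int_ramp that integrable_indicator_density;
        simp add: mult.commute[of _ "std_normal_density _"] mult_left_mono)+
  have "prob {\<omega> \<in> space M. X \<omega> \<le> t} \<le> normal_tail (- t) + B + e" if "e > 0" for e
    using ramp_X(1)[OF that, of t] ramp_normal(2)[OF that, of t] smooth[OF ramp[OF that], of t]
      normal_tail_lipschitz[of "- (t + e)" "- t"] that by linarith
  then have "prob {\<omega> \<in> space M. X \<omega> \<le> t} \<le> normal_tail (- t) + B"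
    by (rule field_le_epsilon)
  moreover have "normal_tail (- t) \<le> (prob {\<omega> \<in> space M. X \<omega> \<le> t} + B) + e" if "e > 0" for e
    using ramp_X(2)[OF that, of "t - e"] ramp_normal(1)[OF that, of "t - e"]
      smooth[OF ramp[OF that], of "t - e"] normal_tail_lipschitz[of "- t" "- (t - e)"] that
    by simp
  then have "normal_tail (- t) \<le> prob {\<omega> \<in> space M. X \<omega> \<le> t} + B"
    by (rule field_le_epsilon)
  ultimately show ?thesis by linarith
qed

lemma normal_cdf_eq:
  "1 / sqrt (2 * pi) * (LBINT x:{..t}. exp (- (x\<^sup>2) / 2)) = normal_tail (- t)"
proof -
  have "normal_tail (- t) = (\<integral>x. 1 / sqrt (2 * pi) * (indicator {..t} x *\<^sub>R exp (- (x\<^sup>2) / 2)) \<partial>lborel)"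
    unfolding normal_lower_tail[symmetric]
    by (intro Bochner_Integration.integral_cong) (auto simp: std_normal_density_def)
  then show ?thesis by (simp add: set_lebesgue_integral_def)
qed

section \<open>Unitary matrices and phase flows\<close>

lemma mult_mat_entry:
  assumes "A \<in> carrier_mat n n" "B \<in> carrier_mat n n" "i < n" "j < n"
  shows "(A * B) $$ (i, j) = (\<Sum>k<n. A $$ (i, k) * B $$ (k, j))"
  using assms by (auto simp: scalar_prod_def lessThan_atLeast0 intro!: sum.cong)

lemma mat_adjoint_carrier: "A \<in> carrier_mat n n \<Longrightarrow> mat_adjoint A \<in> carrier_mat n n"
  unfolding mat_adjoint_def by (auto simp: mat_of_rows_def)

lemma mat_adjoint_entry:
  "A \<in> carrier_mat n n \<Longrightarrow> i < n \<Longrightarrow> j < n \<Longrightarrow> mat_adjoint A $$ (i, j) = cnj (A $$ (j, i))"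
  unfolding mat_adjoint_def by (auto simp: mat_of_rows_def)

lemma mat_adjoint_mult:
  fixes A B :: "complex mat"
  assumes "A \<in> carrier_mat n n" "B \<in> carrier_mat n n"
  shows "mat_adjoint (A * B) = mat_adjoint B * mat_adjoint A"
proof (rule eq_matI)
  have "mat_adjoint A \<in> carrier_mat n n" "mat_adjoint B \<in> carrier_mat n n"
    "mat_adjoint (A * B) \<in> carrier_mat n n"
    using assms by (auto intro: mat_adjoint_carrier)
  note c = this
  fix i j assume "i < dim_row (mat_adjoint B * mat_adjoint A)" "j < dim_col (mat_adjoint B * mat_adjoint A)"
  then have ij: "i < n" "j < n" using c by auto
  have "mat_adjoint (A * B) $$ (i, j) = cnj ((A * B) $$ (j, i))"
    by (rule mat_adjoint_entry[of _ n]) (use assms ij in auto)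
  also have "\<dots> = (\<Sum>k<n. cnj (A $$ (j, k)) * cnj (B $$ (k, i)))"
    using assms ij by (simp add: mult_mat_entry[of _ n] del: index_mult_mat)
  also have "\<dots> = (\<Sum>k<n. mat_adjoint B $$ (i, k) * mat_adjoint A $$ (k, j))"
    using assms ij by (intro sum.cong) (auto simp: mat_adjoint_entry[of _ n] mult.commute)
  also have "\<dots> = (mat_adjoint B * mat_adjoint A) $$ (i, j)"
    using c ij by (simp add: mult_mat_entry[of _ n] del: index_mult_mat)
  finally show "mat_adjoint (A * B) $$ (i, j) = (mat_adjoint B * mat_adjoint A) $$ (i, j)" .
qed (use assms in \<open>auto simp: mat_adjoint_def mat_of_rows_def\<close>)

lemma mat_adjoint_adjoint:
  fixes A :: "complex mat"
  assumes "A \<in> carrier_mat n n"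
  shows "mat_adjoint (mat_adjoint A) = A"
  using assms mat_adjoint_carrier[OF assms] mat_adjoint_carrier[OF mat_adjoint_carrier[OF assms]]
  by (intro eq_matI) (auto simp: mat_adjoint_entry[of _ n])

lemma unitary_carrier: "A \<in> unitary_group n \<Longrightarrow> A \<in> carrier_mat n n"
  by (simp add: unitary_group_def)

lemma unitary_adjoint: "A \<in> unitary_group n \<Longrightarrow> mat_adjoint A \<in> unitary_group n"
  by (auto simp: unitary_group_def mat_adjoint_carrier mat_adjoint_adjoint)

lemma unitary_mult:
  assumes "A \<in> unitary_group n" "B \<in> unitary_group n"
  shows "A * B \<in> unitary_group n"
proof -
  have c: "A \<in> carrier_mat n n" "B \<in> carrier_mat n n" "mat_adjoint A \<in> carrier_mat n n"
    "mat_adjoint B \<in> carrier_mat n n"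
    using assms by (auto simp: unitary_carrier mat_adjoint_carrier)
  have e: "A * mat_adjoint A = 1\<^sub>m n" "mat_adjoint A * A = 1\<^sub>m n"
    "B * mat_adjoint B = 1\<^sub>m n" "mat_adjoint B * B = 1\<^sub>m n"
    using assms by (auto simp: unitary_group_def)
  have "A * B * (mat_adjoint B * mat_adjoint A) = A * (B * mat_adjoint B) * mat_adjoint A"
    using c by (simp add: assoc_mult_mat[where n\<^sub>1=n and n\<^sub>2=n and n\<^sub>3=n and n\<^sub>4=n])
  moreover have "mat_adjoint B * mat_adjoint A * (A * B) = mat_adjoint B * (mat_adjoint A * A) * B"
    using c by (simp add: assoc_mult_mat[where n\<^sub>1=n and n\<^sub>2=n and n\<^sub>3=n and n\<^sub>4=n])
  ultimately show ?thesis
    using c e by (simp add: unitary_group_def mat_adjoint_mult[of _ n])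
qed

lemma unitary_one: "1\<^sub>m n \<in> unitary_group n"
proof -
  have "mat_adjoint (1\<^sub>m n) = (1\<^sub>m n :: complex mat)"
    using mat_adjoint_carrier[of "1\<^sub>m n :: complex mat" n]
    by (intro eq_matI) (auto simp: mat_adjoint_entry[of _ n])
  then show ?thesis by (simp add: unitary_group_def)
qed

lemma unitary_pow:
  assumes "A \<in> unitary_group n"
  shows "A ^\<^sub>m k \<in> unitary_group n"
proof (induction k)
  case 0
  then show ?case using unitary_carrier[OF assms] by (simp add: unitary_one)
next
  case (Suc k)
  then show ?case using assms by (simp add: unitary_mult)
qed

lemma unitary_row_norm:
  assumes "A \<in> unitary_group n" "a < n"
  shows "(\<Sum>b<n. A $$ (a, b) * cnj (A $$ (a, b))) = 1"
proof -
  have c: "A \<in> carrier_mat n n" "mat_adjoint A \<in> carrier_mat n n"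
    using assms by (auto simp: unitary_carrier mat_adjoint_carrier)
  have "(A * mat_adjoint A) $$ (a, a) = 1"
    using assms by (simp add: unitary_group_def)
  then show ?thesis
    using c assms(2) by (simp add: mult_mat_entry[of _ n] mat_adjoint_entry[of _ n] del: index_mult_mat)
qed

lemma unitary_entry_norm_le:
  assumes "A \<in> unitary_group n" "a < n" "b < n"
  shows "norm (A $$ (a, b)) \<le> 1"
proof -
  have "complex_of_real (\<Sum>b<n. (norm (A $$ (a, b)))\<^sup>2) = 1"
    using unitary_row_norm[OF assms(1,2)]
    by (simp only: of_real_sum complex_norm_square)
  then have s: "(\<Sum>b<n. (norm (A $$ (a, b)))\<^sup>2) = 1" by (simp only: of_real_eq_1_iff)
  have "(norm (A $$ (a, b)))\<^sup>2 \<le> (\<Sum>b<n. (norm (A $$ (a, b)))\<^sup>2)"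
    by (rule member_le_sum) (use assms in auto)
  with s show ?thesis by (simp add: abs_square_le_1 power2_le_imp_le)
qed

lemma pow_mat_add_exp:
  fixes A :: "complex mat"
  assumes "A \<in> carrier_mat n n"
  shows "A ^\<^sub>m k * A ^\<^sub>m l = A ^\<^sub>m (k + l)"
proof (induction l)
  case 0
  then show ?case using assms by simp
next
  case (Suc l)
  have "A ^\<^sub>m k * A ^\<^sub>m Suc l = A ^\<^sub>m k * A ^\<^sub>m l * A"
    using assms by (simp add: assoc_mult_mat[where n\<^sub>1=n and n\<^sub>2=n and n\<^sub>3=n and n\<^sub>4=n])
  then show ?case using Suc by simp
qed

definition orthogonal_projection :: "nat \<Rightarrow> complex mat \<Rightarrow> bool" where
  "orthogonal_projection n P \<longleftrightarrow> P \<in> carrier_mat n n \<and> mat_adjoint P = P \<and> P * P = P"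

text \<open>This is \<open>exp(isP)\<close> when \<open>P\<close> is an orthogonal projection: multiplication by the phase \<open>cis s\<close> on the
  range of \<open>P\<close> and the identity on its complement.  The matrices \<open>iP\<close> span the Lie algebra of the
  unitary group over the reals, so the derivatives along these explicit curves
  determine all tangential derivatives.\<close>
definition phase_flow :: "nat \<Rightarrow> complex mat \<Rightarrow> real \<Rightarrow> complex mat" where
  "phase_flow n P s = 1\<^sub>m n + (cis s - 1) \<cdot>\<^sub>m P"

lemma phase_flow_carrier: "P \<in> carrier_mat n n \<Longrightarrow> phase_flow n P s \<in> carrier_mat n n"
  by (auto simp: phase_flow_def)

lemma phase_flow_entry:
  "P \<in> carrier_mat n n \<Longrightarrow> i < n \<Longrightarrow> j < n \<Longrightarrow>
     phase_flow n P s $$ (i, j) = of_bool (i = j) + (cis s - 1) * P $$ (i, j)"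
  by (auto simp: phase_flow_def)

lemma phase_flow_mult_entry:
  assumes "P \<in> carrier_mat n n" "M \<in> carrier_mat n n" "c < n" "d < n"
  shows "(phase_flow n P s * M) $$ (c, d) = M $$ (c, d) + (cis s - 1) * (\<Sum>k<n. P $$ (c, k) * M $$ (k, d))"
proof -
  have "(phase_flow n P s * M) $$ (c, d) =
      (\<Sum>k<n. (of_bool (c = k) + (cis s - 1) * P $$ (c, k)) * M $$ (k, d))"
    using assms
    by (simp add: mult_mat_entry[of _ n] phase_flow_carrier phase_flow_entry del: index_mult_mat)
  also have "\<dots> = (\<Sum>k<n. if c = k then M $$ (k, d) else 0) + (\<Sum>k<n. (cis s - 1) * (P $$ (c, k) * M $$ (k, d)))"
    unfolding sum.distrib[symmetric] by (intro sum.cong) (auto simp: algebra_simps)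
  also have "\<dots> = M $$ (c, d) + (cis s - 1) * (\<Sum>k<n. P $$ (c, k) * M $$ (k, d))"
    using assms by (simp add: sum_distrib_left)
  finally show ?thesis .
qed

lemma phase_flow_0: "P \<in> carrier_mat n n \<Longrightarrow> phase_flow n P 0 = 1\<^sub>m n"
  by (intro eq_matI) (auto simp: phase_flow_def)

lemma phase_flow_add:
  assumes "orthogonal_projection n P"
  shows "phase_flow n P s * phase_flow n P t = phase_flow n P (s + t)"
proof (rule eq_matI)
  have P: "P \<in> carrier_mat n n" "P * P = P" using assms by (auto simp: orthogonal_projection_def)
  fix i j assume "i < dim_row (phase_flow n P (s + t))" "j < dim_col (phase_flow n P (s + t))"
  then have ij: "i < n" "j < n" using phase_flow_carrier[OF P(1), of "s + t"] by auto
  have PP: "(\<Sum>k<n. P $$ (i, k) * P $$ (k, j)) = P $$ (i, j)"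
    using mult_mat_entry[OF P(1) P(1) ij] P(2) by simp
  have "(\<Sum>k<n. P $$ (i, k) * phase_flow n P t $$ (k, j)) =
     (\<Sum>k<n. (if k = j then P $$ (i, k) else 0) + (cis t - 1) * (P $$ (i, k) * P $$ (k, j)))"
    using P ij by (intro sum.cong) (auto simp: phase_flow_entry algebra_simps)
  also have "\<dots> = P $$ (i, j) + (cis t - 1) * (\<Sum>k<n. P $$ (i, k) * P $$ (k, j))"
    using ij by (simp add: sum.distrib sum_distrib_left)
  also have "\<dots> = cis t * P $$ (i, j)"
    unfolding PP by (simp add: algebra_simps)
  finally have "(phase_flow n P s * phase_flow n P t) $$ (i, j) =
     of_bool (i = j) + (cis t - 1) * P $$ (i, j) + (cis s - 1) * (cis t * P $$ (i, j))"
    using P ij by (simp add: phase_flow_mult_entry phase_flow_carrier phase_flow_entry del: index_mult_mat)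
  also have "\<dots> = phase_flow n P (s + t) $$ (i, j)"
    using P ij by (simp add: phase_flow_entry cis_mult[symmetric] algebra_simps)
  finally show "(phase_flow n P s * phase_flow n P t) $$ (i, j) = phase_flow n P (s + t) $$ (i, j)" .
qed (use assms in \<open>auto simp: phase_flow_def orthogonal_projection_def\<close>)

lemma phase_flow_unitary:
  assumes "orthogonal_projection n P"
  shows "phase_flow n P s \<in> unitary_group n"
proof -
  have P: "P \<in> carrier_mat n n" "mat_adjoint P = P" using assms by (auto simp: orthogonal_projection_def)
  have "mat_adjoint (phase_flow n P s) = phase_flow n P (- s)"
  proof (rule eq_matI)
    fix i j assume "i < dim_row (phase_flow n P (- s))" "j < dim_col (phase_flow n P (- s))"
    then have ij: "i < n" "j < n" using phase_flow_carrier[OF P(1), of "- s"] by auto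
    have "cnj (P $$ (j, i)) = P $$ (i, j)" using mat_adjoint_entry[OF P(1) ij] P(2) by simp
    then show "mat_adjoint (phase_flow n P s) $$ (i, j) = phase_flow n P (- s) $$ (i, j)"
      using P ij by (simp add: mat_adjoint_entry[of _ n] phase_flow_carrier phase_flow_entry cis_cnj)
  qed (use phase_flow_carrier[OF P(1), of s] phase_flow_carrier[OF P(1), of "- s"]
      mat_adjoint_carrier[OF phase_flow_carrier[OF P(1)], of s] in auto)
  then show ?thesis
    using assms P phase_flow_add[OF assms, of s "- s"] phase_flow_add[OF assms, of "- s" s]
    by (simp add: unitary_group_def phase_flow_carrier phase_flow_0)
qed

section \<open>Gradients of functions on the unitary group\<close>

text \<open>A class of integrable functions that does not refer to the measure and, unlike integrability, is
  closed under products.\<close>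
definition regular :: "nat \<Rightarrow> (complex mat \<Rightarrow> complex) \<Rightarrow> bool" where
  "regular n F \<longleftrightarrow> F \<in> borel_measurable (unitary_borel n) \<and> (\<exists>B. \<forall>M\<in>unitary_group n. norm (F M) \<le> B)"

lemma space_unitary_borel [simp]: "space (unitary_borel n) = unitary_group n"
  by (simp add: unitary_borel_def)

lemma regular_bound:
  assumes "regular n F"
  obtains B where "B \<ge> 0" "\<And>M. M \<in> unitary_group n \<Longrightarrow> norm (F M) \<le> B"
proof -
  obtain B where "\<forall>M\<in>unitary_group n. norm (F M) \<le> B" using assms by (auto simp: regular_def)
  then show thesis by (intro that[of "max 0 B"]) auto
qed

lemma regular_measurable: "regular n F \<Longrightarrow> F \<in> borel_measurable (unitary_borel n)"
  by (simp add: regular_def)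

lemma regularI:
  "F \<in> borel_measurable (unitary_borel n) \<Longrightarrow> (\<And>M. M \<in> unitary_group n \<Longrightarrow> norm (F M) \<le> B) \<Longrightarrow> regular n F"
  by (auto simp: regular_def)

lemma regular_cong:
  "regular n F \<Longrightarrow> (\<And>M. M \<in> unitary_group n \<Longrightarrow> F M = F' M) \<Longrightarrow> regular n F'"
  unfolding regular_def by (subst measurable_cong[of _ F' F]) auto

lemma regular_const: "regular n (\<lambda>M. c)"
  by (auto simp: regular_def)

lemma regular_add:
  assumes "regular n F" "regular n G"
  shows "regular n (\<lambda>M. F M + G M)"
proof -
  obtain B where B: "B \<ge> 0" "\<And>M. M \<in> unitary_group n \<Longrightarrow> norm (F M) \<le> B"
    using regular_bound[OF assms(1)] by blast
  obtain C where C: "C \<ge> 0" "\<And>M. M \<in> unitary_group n \<Longrightarrow> norm (G M) \<le> C"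
    using regular_bound[OF assms(2)] by blast
  have "norm (F M + G M) \<le> B + C" if "M \<in> unitary_group n" for M
    using that by (intro norm_triangle_le add_mono B C)
  then show ?thesis
    using assms[THEN regular_measurable] by (intro regularI[where B = "B + C"] borel_measurable_add)
qed

lemma regular_mult:
  assumes "regular n F" "regular n G"
  shows "regular n (\<lambda>M. F M * G M)"
proof -
  obtain B where B: "B \<ge> 0" "\<And>M. M \<in> unitary_group n \<Longrightarrow> norm (F M) \<le> B"
    using regular_bound[OF assms(1)] by blast
  obtain C where C: "C \<ge> 0" "\<And>M. M \<in> unitary_group n \<Longrightarrow> norm (G M) \<le> C"
    using regular_bound[OF assms(2)] by blast
  have "norm (F M * G M) \<le> B * C" if "M \<in> unitary_group n" for M
    unfolding norm_mult using that by (intro mult_mono B C) auto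
  then show ?thesis
    using assms[THEN regular_measurable] by (intro regularI[where B = "B * C"] borel_measurable_times)
qed

lemma regular_sum: "(\<And>i. i \<in> I \<Longrightarrow> regular n (F i)) \<Longrightarrow> regular n (\<lambda>M. \<Sum>i\<in>I. F i M)"
proof (induction I rule: infinite_finite_induct)
  case (insert i I)
  then show ?case by (simp add: regular_add)
qed (simp_all add: regular_const)

lemma regular_cnj:
  assumes "regular n F"
  shows "regular n (\<lambda>M. cnj (F M))"
proof -
  obtain B where "B \<ge> 0" and B: "\<And>M. M \<in> unitary_group n \<Longrightarrow> norm (F M) \<le> B"
    using regular_bound[OF assms] by blast
  have "(\<lambda>M. cnj (F M)) \<in> borel_measurable (unitary_borel n)"
    by (rule borel_measurable_continuous_on[OF _ regular_measurable[OF assms]]) (intro continuous_intros)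
  then show ?thesis by (rule regularI[where B = B]) (simp add: B)
qed

lemma regular_of_real_compose:
  assumes W: "regular n (\<lambda>M. complex_of_real (W M))"
    and f: "continuous_on UNIV (f :: real \<Rightarrow> real)" "\<And>w. \<bar>f w\<bar> \<le> B"
  shows "regular n (\<lambda>M. complex_of_real (f (W M)))"
proof (rule regularI)
  have "(\<lambda>M. Re (complex_of_real (W M))) \<in> borel_measurable (unitary_borel n)"
    by (rule measurable_compose[OF regular_measurable[OF W] borel_measurable_Re])
  then have "W \<in> borel_measurable (unitary_borel n)" by simp
  then have "(\<lambda>M. f (W M)) \<in> borel_measurable (unitary_borel n)"
    by (rule borel_measurable_continuous_on[OF f(1)])
  then show "(\<lambda>M. complex_of_real (f (W M))) \<in> borel_measurable (unitary_borel n)"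
    by (rule measurable_compose[OF _ borel_measurable_of_real]) 
  show "norm (complex_of_real (f (W M))) \<le> B" for M using f(2) by simp
qed

lemma regular_entry:
  assumes "c < n" "d < n"
  shows "regular n (\<lambda>M. M $$ (c, d))"
proof -
  have "mat_entries n \<in> measurable (unitary_borel n) borel"
    unfolding unitary_borel_def by (rule measurable_vimage_algebra1) auto
  moreover have "(\<lambda>f. f (c, d)) \<in> borel_measurable (borel :: (nat \<times> nat \<Rightarrow> complex) measure)"
    by (rule borel_measurable_continuous_onI) (rule continuous_on_product_coordinates)
  ultimately have "(\<lambda>M. mat_entries n M (c, d)) \<in> borel_measurable (unitary_borel n)"
    by (rule measurable_compose)
  then have "(\<lambda>M. M $$ (c, d)) \<in> borel_measurable (unitary_borel n)"
    using assms by (simp add: mat_entries_def)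
  then show ?thesis
    by (rule regularI[where B = 1]) (use assms in \<open>auto intro: unitary_entry_norm_le\<close>)
qed

text \<open>\<open>G a b\<close> is the derivative of \<open>F\<close> in the direction of the matrix unit \<open>E\<^sub>a\<^sub>b\<close>.  This direction is not
  tangent to the unitary group; \<open>G\<close> is the complex-linear extension of the derivative along the
  tangent directions, and is pinned down by its values on the matrices \<open>iP\<close>.\<close>
definition has_gradient ::
    "nat \<Rightarrow> (complex mat \<Rightarrow> complex) \<Rightarrow> (nat \<Rightarrow> nat \<Rightarrow> complex mat \<Rightarrow> complex) \<Rightarrow> bool" where
  "has_gradient n F G \<longleftrightarrow>
     regular n F \<and> (\<forall>a<n. \<forall>b<n. regular n (G a b)) \<and>
     (\<forall>P M. orthogonal_projection n P \<longrightarrow> M \<in> unitary_group n \<longrightarrow>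
       ((\<lambda>s. F (phase_flow n P s * M)) has_vector_derivative
         (\<i> * (\<Sum>a<n. \<Sum>b<n. P $$ (a, b) * G a b M))) (at 0))"

lemma has_gradient_regular: "has_gradient n F G \<Longrightarrow> regular n F"
  by (simp add: has_gradient_def)

lemma has_gradient_regular': "has_gradient n F G \<Longrightarrow> a < n \<Longrightarrow> b < n \<Longrightarrow> regular n (G a b)"
  by (simp add: has_gradient_def)

lemma phase_flow_at_0: "orthogonal_projection n P \<Longrightarrow> M \<in> unitary_group n \<Longrightarrow> phase_flow n P 0 * M = M"
  by (auto simp: orthogonal_projection_def phase_flow_0 dest: unitary_carrier)

lemma has_gradient_cong:
  assumes "has_gradient n F G"
    and F: "\<And>M. M \<in> unitary_group n \<Longrightarrow> F M = F' M"
    and G: "\<And>a b M. a < n \<Longrightarrow> b < n \<Longrightarrow> M \<in> unitary_group n \<Longrightarrow> G a b M = G' a b M"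
  shows "has_gradient n F' G'"
  unfolding has_gradient_def
proof (intro conjI allI impI)
  show "regular n F'" using has_gradient_regular[OF assms(1)] F by (rule regular_cong)
  show "regular n (G' a b)" if "a < n" "b < n" for a b
    using has_gradient_regular'[OF assms(1) that] G that by (auto intro: regular_cong)
  fix P M assume PM: "orthogonal_projection n P" "M \<in> unitary_group n"
  have "F' (phase_flow n P s * M) = F (phase_flow n P s * M)" for s
    using F unitary_mult[OF phase_flow_unitary[OF PM(1)] PM(2)] by simp
  moreover have "(\<Sum>a<n. \<Sum>b<n. P $$ (a, b) * G' a b M) = (\<Sum>a<n. \<Sum>b<n. P $$ (a, b) * G a b M)"
    using G PM by (auto intro!: sum.cong)
  ultimately show "((\<lambda>s. F' (phase_flow n P s * M)) has_vector_derivative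
         (\<i> * (\<Sum>a<n. \<Sum>b<n. P $$ (a, b) * G' a b M))) (at 0)"
    using assms(1) PM by (simp add: has_gradient_def)
qed

lemma has_gradient_const: "has_gradient n (\<lambda>M. c) (\<lambda>a b M. 0)"
  by (simp add: has_gradient_def regular_const has_vector_derivative_const)

lemma has_gradient_add:
  assumes "has_gradient n F G" "has_gradient n F' G'"
  shows "has_gradient n (\<lambda>M. F M + F' M) (\<lambda>a b M. G a b M + G' a b M)"
  unfolding has_gradient_def
proof (intro conjI allI impI regular_add)
  fix P M assume PM: "orthogonal_projection n P" "M \<in> unitary_group n"
  have "((\<lambda>s. F (phase_flow n P s * M) + F' (phase_flow n P s * M)) has_vector_derivative
     (\<i> * (\<Sum>a<n. \<Sum>b<n. P $$ (a, b) * G a b M) + \<i> * (\<Sum>a<n. \<Sum>b<n. P $$ (a, b) * G' a b M))) (at 0)"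
    using assms PM by (intro has_vector_derivative_add) (auto simp: has_gradient_def)
  then show "((\<lambda>s. F (phase_flow n P s * M) + F' (phase_flow n P s * M)) has_vector_derivative
     (\<i> * (\<Sum>a<n. \<Sum>b<n. P $$ (a, b) * (G a b M + G' a b M)))) (at 0)"
    by (simp add: sum.distrib distrib_left)
qed (use assms in \<open>auto simp: has_gradient_def\<close>)

lemma has_gradient_mult:
  assumes "has_gradient n F G" "has_gradient n F' G'"
  shows "has_gradient n (\<lambda>M. F M * F' M) (\<lambda>a b M. G a b M * F' M + F M * G' a b M)"
  unfolding has_gradient_def
proof (intro conjI allI impI regular_add regular_mult)
  fix P M assume PM: "orthogonal_projection n P" "M \<in> unitary_group n"
  have "((\<lambda>s. F (phase_flow n P s * M) * F' (phase_flow n P s * M)) has_vector_derivative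
     (F (phase_flow n P 0 * M) * (\<i> * (\<Sum>a<n. \<Sum>b<n. P $$ (a, b) * G' a b M))
       + \<i> * (\<Sum>a<n. \<Sum>b<n. P $$ (a, b) * G a b M) * F' (phase_flow n P 0 * M))) (at 0)"
    using assms PM by (intro has_vector_derivative_mult) (auto simp: has_gradient_def)
  then show "((\<lambda>s. F (phase_flow n P s * M) * F' (phase_flow n P s * M)) has_vector_derivative
     (\<i> * (\<Sum>a<n. \<Sum>b<n. P $$ (a, b) * (G a b M * F' M + F M * G' a b M)))) (at 0)"
    by (simp add: phase_flow_at_0[OF PM] sum.distrib sum_distrib_left sum_distrib_right algebra_simps)
qed (use assms in \<open>auto simp: has_gradient_def\<close>)

lemma has_gradient_cmult:
  assumes "has_gradient n F G"
  shows "has_gradient n (\<lambda>M. c * F M) (\<lambda>a b M. c * G a b M)"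
  using has_gradient_mult[OF has_gradient_const[of n c] assms] by simp

lemma has_gradient_sum:
  "(\<And>i. i \<in> I \<Longrightarrow> has_gradient n (F i) (G i)) \<Longrightarrow>
     has_gradient n (\<lambda>M. \<Sum>i\<in>I. F i M) (\<lambda>a b M. \<Sum>i\<in>I. G i a b M)"
proof (induction I rule: infinite_finite_induct)
  case (insert i I)
  then show ?case by (simp add: has_gradient_add)
qed (simp_all add: has_gradient_const)

text \<open>Conjugation is not complex linear, and it turns the direction \<open>E\<^sub>a\<^sub>b\<close> into minus its adjoint
  \<open>- E\<^sub>b\<^sub>a\<close>; the projections being Hermitian, this is what conjugating the coefficients of \<open>P\<close>
  yields.\<close>
lemma has_gradient_cnj:
  assumes "has_gradient n F G"
  shows "has_gradient n (\<lambda>M. cnj (F M)) (\<lambda>a b M. - cnj (G b a M))"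
  unfolding has_gradient_def
proof (intro conjI allI impI regular_cnj)
  show "regular n (\<lambda>M. - cnj (G b a M))" if "a < n" "b < n" for a b
    using regular_mult[OF regular_const[of n "- 1"] regular_cnj[OF has_gradient_regular'[OF assms that(2,1)]]]
    by simp
  fix P M assume PM: "orthogonal_projection n P" "M \<in> unitary_group n"
  then have P: "P \<in> carrier_mat n n" "mat_adjoint P = P" by (auto simp: orthogonal_projection_def)
  have P_cnj: "cnj (P $$ (a, b)) = P $$ (b, a)" if "a < n" "b < n" for a b
    using mat_adjoint_entry[OF P(1) that(2,1)] P(2) by simp
  have "((\<lambda>s. cnj (F (phase_flow n P s * M))) has_vector_derivative
     cnj (\<i> * (\<Sum>a<n. \<Sum>b<n. P $$ (a, b) * G a b M))) (at 0)"
    using assms PM by (intro has_vector_derivative_cnj) (auto simp: has_gradient_def)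
  also have "cnj (\<i> * (\<Sum>a<n. \<Sum>b<n. P $$ (a, b) * G a b M)) =
     \<i> * (\<Sum>a<n. \<Sum>b<n. cnj (P $$ (a, b)) * - cnj (G a b M))"
    by (simp add: sum_negf)
  also have "(\<Sum>a<n. \<Sum>b<n. cnj (P $$ (a, b)) * - cnj (G a b M)) =
     (\<Sum>a<n. \<Sum>b<n. P $$ (b, a) * - cnj (G a b M))"
    by (intro sum.cong refl) (simp add: P_cnj)
  also have "\<dots> = (\<Sum>a<n. \<Sum>b<n. P $$ (a, b) * - cnj (G b a M))"
    by (rule sum.swap)
  finally show "((\<lambda>s. cnj (F (phase_flow n P s * M))) has_vector_derivative
     (\<i> * (\<Sum>a<n. \<Sum>b<n. P $$ (a, b) * - cnj (G b a M)))) (at 0)" .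
qed (use assms in \<open>auto simp: has_gradient_def\<close>)

text \<open>The chain rule along the flow is real; it extends to all complex directions because the flow
  derivative of a real function is real.\<close>
lemma has_gradient_of_real_compose:
  assumes W: "has_gradient n (\<lambda>M. complex_of_real (W M)) G"
    and f: "\<And>w. (f has_real_derivative f' w) (at w)" "continuous_on UNIV f'"
      "\<And>w. \<bar>f w\<bar> \<le> B" "\<And>w. \<bar>f' w\<bar> \<le> B'"
  shows "has_gradient n (\<lambda>M. complex_of_real (f (W M))) (\<lambda>a b M. complex_of_real (f' (W M)) * G a b M)"
  unfolding has_gradient_def
proof (intro conjI allI impI regular_mult)
  have "continuous_on UNIV f" using f(1) by (meson DERIV_isCont continuous_at_imp_continuous_on)
  then show "regular n (\<lambda>M. complex_of_real (f (W M)))"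
    using f(3) by (rule regular_of_real_compose[OF has_gradient_regular[OF W]])
  show "regular n (\<lambda>M. complex_of_real (f' (W M)))"
    using f(2,4) by (rule regular_of_real_compose[OF has_gradient_regular[OF W]])
  fix P M assume PM: "orthogonal_projection n P" "M \<in> unitary_group n"
  define D where "D = \<i> * (\<Sum>a<n. \<Sum>b<n. P $$ (a, b) * G a b M)"
  define w where "w = (\<lambda>s. W (phase_flow n P s * M))"
  have D: "((\<lambda>s. complex_of_real (w s)) has_vector_derivative D) (at 0)"
    using W PM unfolding has_gradient_def D_def w_def by blast
  have "((\<lambda>s. Im (complex_of_real (w s))) has_vector_derivative Im D) (at 0)"
    by (rule bounded_linear.has_vector_derivative[OF bounded_linear_Im D])
  then have "Im D = 0"
    using vector_derivative_unique_at[OF _ has_vector_derivative_const] by fastforce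
  then have ReD: "complex_of_real (Re D) = D" by (intro complex_eqI) auto
  have "(w has_real_derivative Re D) (at 0)"
    using bounded_linear.has_vector_derivative[OF bounded_linear_Re D]
    by (simp add: has_real_derivative_iff_has_vector_derivative)
  then have "((\<lambda>s. f (w s)) has_real_derivative f' (w 0) * Re D) (at 0)"
    by (rule DERIV_chain2[OF f(1)])
  then have "((\<lambda>s. complex_of_real (f (w s))) has_vector_derivative complex_of_real (f' (w 0) * Re D)) (at 0)"
    by (intro has_vector_derivative_of_real) (simp add: has_real_derivative_iff_has_vector_derivative)
  also have "complex_of_real (f' (w 0) * Re D) = complex_of_real (f' (W M)) * D"
    unfolding of_real_mult ReD by (simp add: w_def phase_flow_at_0[OF PM])
  also have "\<dots> = \<i> * (\<Sum>a<n. \<Sum>b<n. P $$ (a, b) * (complex_of_real (f' (W M)) * G a b M))"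
    unfolding D_def by (simp add: sum_distrib_left mult_ac)
  finally show "((\<lambda>s. complex_of_real (f (W (phase_flow n P s * M)))) has_vector_derivative
      (\<i> * (\<Sum>a<n. \<Sum>b<n. P $$ (a, b) * (complex_of_real (f' (W M)) * G a b M)))) (at 0)"
    unfolding w_def .
qed (use W in \<open>auto simp: has_gradient_def\<close>)

lemma has_gradient_entry:
  assumes "c < n" "d < n"
  shows "has_gradient n (\<lambda>M. M $$ (c, d)) (\<lambda>a b M. if a = c then M $$ (b, d) else 0)"
  unfolding has_gradient_def
proof (intro conjI allI impI)
  show "regular n (\<lambda>M. if a = c then M $$ (b, d) else 0)" if "a < n" "b < n" for a b
    using regular_entry[OF that(2) assms(2)] regular_const[of n 0] by (cases "a = c") simp_all
  fix P M assume PM: "orthogonal_projection n P" "M \<in> unitary_group n"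
  then have P: "P \<in> carrier_mat n n" "M \<in> carrier_mat n n"
    by (auto simp: orthogonal_projection_def unitary_carrier)
  let ?S = "\<Sum>k<n. P $$ (c, k) * M $$ (k, d)"
  have "(cis has_vector_derivative \<i> * cis 0) (at 0)"
  proof -
    have "((\<lambda>z. exp (\<i> * z)) has_field_derivative \<i> * cis 0) (at (complex_of_real 0))"
      by (auto intro!: derivative_eq_intros)
    then have "((\<lambda>s. exp (\<i> * complex_of_real s)) has_vector_derivative \<i> * cis 0) (at 0)"
      by (rule has_vector_derivative_real_field)
    then show ?thesis by (simp add: cis_conv_exp[abs_def])
  qed
  then have "((\<lambda>s. M $$ (c, d) + (cis s - 1) * ?S) has_vector_derivative \<i> * ?S) (at 0)"
    by (auto intro!: derivative_eq_intros)
  moreover have "(\<Sum>a<n. \<Sum>b<n. P $$ (a, b) * (if a = c then M $$ (b, d) else 0)) = ?S"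
  proof -
    have "(\<Sum>a<n. \<Sum>b<n. P $$ (a, b) * (if a = c then M $$ (b, d) else 0)) =
       (\<Sum>a<n. if a = c then (\<Sum>b<n. P $$ (c, b) * M $$ (b, d)) else 0)"
      by (intro sum.cong) auto
    then show ?thesis using assms by simp
  qed
  ultimately show "((\<lambda>s. (phase_flow n P s * M) $$ (c, d)) has_vector_derivative
      (\<i> * (\<Sum>a<n. \<Sum>b<n. P $$ (a, b) * (if a = c then M $$ (b, d) else 0)))) (at 0)"
    using phase_flow_mult_entry[OF P assms] by simp
qed (use assms in \<open>auto simp: regular_entry\<close>)

section \<open>Haar measure and integration by parts\<close>

locale haar_unitary =
  fixes n :: nat and \<mu> :: "complex mat measure"
  assumes haar: "haar_prob_measure n \<mu>"

sublocale haar_unitary \<subseteq> prob_space \<mu>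
  using haar by (simp add: haar_prob_measure_def)

context haar_unitary
begin

lemma space_haar [simp]: "space \<mu> = unitary_group n"
  using haar by (simp add: haar_prob_measure_def)

lemma prob_unitary_group [simp]: "prob (unitary_group n) = 1"
  using prob_space by simp

lemma sets_haar: "sets \<mu> = sets (unitary_borel n)"
  using haar by (simp add: haar_prob_measure_def)

lemma regular_measurable_haar: "regular n F \<Longrightarrow> F \<in> borel_measurable \<mu>"
  using regular_measurable measurable_cong_sets[OF sets_haar refl] by blast

lemma regular_integrable:
  assumes "regular n F"
  shows "integrable \<mu> F"
proof -
  obtain B where "\<And>M. M \<in> unitary_group n \<Longrightarrow> norm (F M) \<le> B"
    using regular_bound[OF assms] by blast
  then show ?thesis
    by (intro integrable_const_bound[where B = B] AE_I2 regular_measurable_haar[OF assms]) simp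
qed

text \<open>Coordinatewise, left multiplication is linear in the entries.\<close>
lemma left_mult_measurable:
  assumes "A \<in> unitary_group n"
  shows "(\<lambda>M. A * M) \<in> measurable \<mu> \<mu>"
proof -
  have "(\<lambda>M. A * M) \<in> measurable \<mu> (unitary_borel n)"
    unfolding unitary_borel_def
  proof (rule measurable_vimage_algebra2)
    show "(\<lambda>M. A * M) \<in> space \<mu> \<rightarrow> unitary_group n"
      using assms by (auto intro: unitary_mult)
    show "(\<lambda>M. mat_entries n (A * M)) \<in> borel_measurable \<mu>"
    proof (rule measurable_coordinatewise_then_product)
      fix ik :: "nat \<times> nat"
      obtain i k where ik: "ik = (i, k)" by (cases ik)
      show "(\<lambda>M. mat_entries n (A * M) ik) \<in> borel_measurable \<mu>"
      proof (cases "i < n \<and> k < n")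
        case True
        have "regular n (\<lambda>M. \<Sum>l<n. A $$ (i, l) * M $$ (l, k))"
          using True by (intro regular_sum regular_mult regular_const regular_entry) auto
        then have "regular n (\<lambda>M. mat_entries n (A * M) ik)"
          by (rule regular_cong)
            (use True ik mult_mat_entry[OF unitary_carrier[OF assms] unitary_carrier, of _ i k]
              in \<open>simp add: mat_entries_def\<close>)
        then show ?thesis by (rule regular_measurable_haar)
      next
        case False
        then have "(\<lambda>M. mat_entries n (A * M) ik) = (\<lambda>M. 0)"
          using ik by (auto simp: mat_entries_def)
        then show ?thesis by simp
      qed
    qed
  qed
  then show ?thesis using measurable_cong_sets[OF refl sets_haar] by blast
qed

text \<open>The measure is given as invariant under images; since left multiplication by the adjoint undoes
  left multiplication by \<open>A\<close>, the image under one is the preimage under the other.\<close>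
lemma haar_left_invariant:
  assumes "A \<in> unitary_group n" "regular n F"
  shows "expectation (\<lambda>M. F (A * M)) = expectation F"
proof -
  have "distr \<mu> \<mu> (\<lambda>M. A * M) = \<mu>"
  proof (rule measure_eqI)
    fix S assume "S \<in> sets (distr \<mu> \<mu> (\<lambda>M. A * M))"
    then have S: "S \<in> sets \<mu>" by simp
    then have SU: "S \<subseteq> unitary_group n" using sets.sets_into_space[OF S] by simp
    have A': "mat_adjoint A \<in> unitary_group n" by (rule unitary_adjoint[OF assms(1)])
    have inv: "mat_adjoint A * (A * M) = M" "A * (mat_adjoint A * M) = M"
      if "M \<in> unitary_group n" for M
    proof -
      have c: "A \<in> carrier_mat n n" "mat_adjoint A \<in> carrier_mat n n" "M \<in> carrier_mat n n"
        using assms(1) A' that by (auto intro: unitary_carrier)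
      have "mat_adjoint A * A = 1\<^sub>m n" "A * mat_adjoint A = 1\<^sub>m n"
        using assms(1) by (auto simp: unitary_group_def)
      then show "mat_adjoint A * (A * M) = M" "A * (mat_adjoint A * M) = M"
        using c by (simp_all flip: assoc_mult_mat[OF c(2,1,3)] assoc_mult_mat[OF c(1,2,3)])
    qed
    have "emeasure (distr \<mu> \<mu> (\<lambda>M. A * M)) S = emeasure \<mu> ((\<lambda>M. A * M) -` S \<inter> unitary_group n)"
      using emeasure_distr[OF left_mult_measurable[OF assms(1)] S] by simp
    also have "(\<lambda>M. A * M) -` S \<inter> unitary_group n = (\<lambda>M. mat_adjoint A * M) ` S"
    proof (intro equalityI subsetI)
      fix M assume "M \<in> (\<lambda>M. A * M) -` S \<inter> unitary_group n"
      then show "M \<in> (\<lambda>M. mat_adjoint A * M) ` S"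
        using inv(1)[of M] by (intro image_eqI[of _ _ "A * M"]) auto
    next
      fix M assume "M \<in> (\<lambda>M. mat_adjoint A * M) ` S"
      then show "M \<in> (\<lambda>M. A * M) -` S \<inter> unitary_group n"
        using SU inv(2) unitary_mult[OF A'] by auto
    qed
    also have "emeasure \<mu> ((\<lambda>M. mat_adjoint A * M) ` S) = emeasure \<mu> S"
      using haar A' S by (simp add: haar_prob_measure_def)
    finally show "emeasure (distr \<mu> \<mu> (\<lambda>M. A * M)) S = emeasure \<mu> S" .
  qed simp
  then show ?thesis
    using integral_distr[OF left_mult_measurable[OF assms(1)] regular_measurable_haar[OF assms(2)]]
    by simp
qed

text \<open>The mean of \<open>F\<close> does not change along the flow, so all difference quotients have mean zero.  By
  the group law the derivative at any time is the derivative at time 0 at the transported point;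
  hence the difference quotients are uniformly bounded and dominated convergence applies.\<close>
lemma expectation_flow_derivative:
  assumes FG: "has_gradient n F G" and P: "orthogonal_projection n P"
  shows "expectation (\<lambda>M. \<Sum>a<n. \<Sum>b<n. P $$ (a, b) * G a b M) = 0"
proof -
  define D where "D = (\<lambda>M. \<i> * (\<Sum>a<n. \<Sum>b<n. P $$ (a, b) * G a b M))"
  have regD: "regular n D"
    unfolding D_def
    by (intro regular_mult regular_const regular_sum has_gradient_regular'[OF FG]) auto
  obtain B where B: "\<And>M. M \<in> unitary_group n \<Longrightarrow> norm (D M) \<le> B"
    using regular_bound[OF regD] by blast
  have U: "phase_flow n P s * M \<in> unitary_group n" if "M \<in> unitary_group n" for s M
    using phase_flow_unitary[OF P] that by (rule unitary_mult)
  have at0: "((\<lambda>s. F (phase_flow n P s * M)) has_vector_derivative D M) (at 0)"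
    if "M \<in> unitary_group n" for M
    using FG P that unfolding has_gradient_def D_def by blast
  have deriv: "((\<lambda>s. F (phase_flow n P s * M)) has_vector_derivative D (phase_flow n P t * M)) (at t)"
    if M: "M \<in> unitary_group n" for M t
  proof -
    have "((\<lambda>s. F (phase_flow n P s * (phase_flow n P t * M))) has_vector_derivative
        D (phase_flow n P t * M)) (at (t - t))"
      using at0[OF U[OF M]] by simp
    moreover have "((\<lambda>u. u - t) has_vector_derivative 1) (at t)"
      by (auto intro!: derivative_eq_intros)
    ultimately have "(((\<lambda>s. F (phase_flow n P s * (phase_flow n P t * M))) \<circ> (\<lambda>u. u - t))
        has_vector_derivative 1 *\<^sub>R D (phase_flow n P t * M)) (at t)"
      by (intro vector_diff_chain_at)
    moreover have "phase_flow n P (u - t) * (phase_flow n P t * M) = phase_flow n P u * M" for u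
    proof -
      have c: "phase_flow n P s \<in> carrier_mat n n" "M \<in> carrier_mat n n" for s
        using M phase_flow_unitary[OF P] by (auto intro: unitary_carrier)
      show ?thesis
        unfolding assoc_mult_mat[OF c(1) c(1) c(2), symmetric] phase_flow_add[OF P] by simp
    qed
    ultimately show ?thesis by (simp add: o_def)
  qed
  \<comment> \<open>\<open>q m\<close> is the difference quotient with step \<open>1 / (m + 1)\<close>, written as a sum so that the closure
    rules for regular functions apply literally.\<close>
  define q where "q = (\<lambda>(m::nat) M. of_nat (Suc m) * (F (phase_flow n P (1 / real (Suc m)) * M) + (- 1) * F M))"
  have regF: "regular n F" using FG by (rule has_gradient_regular)
  have regFA: "regular n (\<lambda>M. F (phase_flow n P s * M))" for s
  proof -
    obtain C where C: "\<And>M. M \<in> unitary_group n \<Longrightarrow> norm (F M) \<le> C"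
      using regular_bound[OF regF] by blast
    have "(\<lambda>M. F (phase_flow n P s * M)) \<in> borel_measurable \<mu>"
      by (rule measurable_compose[OF left_mult_measurable[OF phase_flow_unitary[OF P]]
            regular_measurable_haar[OF regF]])
    then have "(\<lambda>M. F (phase_flow n P s * M)) \<in> borel_measurable (unitary_borel n)"
      using measurable_cong_sets[OF sets_haar refl] by blast
    then show ?thesis by (rule regularI) (rule C[OF U])
  qed
  have Eq: "expectation (q m) = 0" for m
    unfolding q_def
    using haar_left_invariant[OF phase_flow_unitary[OF P] regF, of "1 / real (Suc m)"]
      regular_integrable[OF regF] regular_integrable[OF regFA[of "1 / real (Suc m)"]]
    by (simp del: of_nat_Suc)
  have qB: "norm (q m M) \<le> B" if M: "M \<in> unitary_group n" for m M
  proof -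
    have "norm (F (phase_flow n P (1 / real (Suc m)) * M) - F (phase_flow n P 0 * M))
        \<le> B * norm (1 / real (Suc m) - 0)"
    proof (rule differentiable_bound[where S = UNIV])
      show "((\<lambda>s. F (phase_flow n P s * M)) has_derivative (\<lambda>h. h *\<^sub>R D (phase_flow n P t * M))) (at t within UNIV)" for t
        using deriv[OF M] by (simp add: has_vector_derivative_def)
      show "onorm (\<lambda>h. h *\<^sub>R D (phase_flow n P t * M)) \<le> B" for t
        using B[OF U[OF M, of t]]
        by (intro onorm_bound order_trans[OF norm_ge_zero B[OF M]])
          (auto simp: mult.commute[of B] intro!: mult_left_mono)
    qed auto
    then have "norm (F (phase_flow n P (1 / real (Suc m)) * M) - F M) * real (Suc m) \<le> B"
      using phase_flow_at_0[OF P M] by (simp add: field_simps)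
    then show ?thesis by (simp add: q_def norm_mult mult.commute del: of_nat_Suc)
  qed
  have qlim: "(\<lambda>m. q m M) \<longlonglongrightarrow> D M" if M: "M \<in> unitary_group n" for M
  proof -
    have "((\<lambda>h. norm (F (phase_flow n P h * M) - F M - h *\<^sub>R D M) / norm h) \<longlongrightarrow> 0) (at 0)"
      using at0[OF M] phase_flow_at_0[OF P M]
      by (simp add: has_vector_derivative_def has_derivative_at)
    moreover have "filterlim (\<lambda>m. 1 / real (Suc m)) (at 0) sequentially"
      by real_asymp
    ultimately have "(\<lambda>m. norm (F (phase_flow n P (1 / real (Suc m)) * M) - F M - (1 / real (Suc m)) *\<^sub>R D M)
        / norm (1 / real (Suc m))) \<longlonglongrightarrow> 0"
      by (rule filterlim_compose)
    moreover have "norm (F (phase_flow n P (1 / real (Suc m)) * M) - F M - (1 / real (Suc m)) *\<^sub>R D M)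
        / norm (1 / real (Suc m)) = norm (q m M - D M)" for m
    proof -
      have "q m M - D M = of_nat (Suc m) *
          (F (phase_flow n P (1 / real (Suc m)) * M) - F M - (1 / real (Suc m)) *\<^sub>R D M)"
        by (simp add: q_def scaleR_conv_of_real right_diff_distrib del: of_nat_Suc)
      then show ?thesis by (simp add: norm_mult del: of_nat_Suc)
    qed
    ultimately show ?thesis by (simp add: tendsto_norm_zero_iff LIM_zero_iff)
  qed
  have "(\<lambda>m. expectation (q m)) \<longlonglongrightarrow> expectation D"
  proof (rule integral_dominated_convergence[where w = "\<lambda>_. B"])
    show "D \<in> borel_measurable \<mu>" by (rule regular_measurable_haar[OF regD])
    show "q m \<in> borel_measurable \<mu>" for m
      unfolding q_def
      by (intro regular_measurable_haar regular_mult regular_add regular_const regFA regF)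
  qed (use qB qlim in auto)
  then have "expectation D = 0" by (simp add: Eq LIMSEQ_const_iff)
  moreover have "expectation D = \<i> * expectation (\<lambda>M. \<Sum>a<n. \<Sum>b<n. P $$ (a, b) * G a b M)"
    unfolding D_def by (rule integral_mult_right_zero)
  ultimately show ?thesis by simp
qed

lemma orthogonal_projection_rank_one:
  assumes "(\<Sum>k<n. v k * cnj (v k)) = 1"
  shows "orthogonal_projection n (mat n n (\<lambda>(i, j). v i * cnj (v j)))"
proof -
  let ?P = "mat n n (\<lambda>(i, j). v i * cnj (v j))"
  have c: "?P \<in> carrier_mat n n" by simp
  have "mat_adjoint ?P = ?P"
    by (rule eq_matI)
      (use mat_adjoint_carrier[OF c] in \<open>auto simp: mat_adjoint_entry[OF c]\<close>)
  moreover have "?P * ?P = ?P"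
  proof (rule eq_matI)
    fix i j assume "i < dim_row ?P" "j < dim_col ?P"
    then have ij: "i < n" "j < n" by auto
    have "(?P * ?P) $$ (i, j) = (\<Sum>k<n. v i * cnj (v k) * (v k * cnj (v j)))"
      unfolding mult_mat_entry[OF c c ij] using ij by (intro sum.cong) auto
    also have "\<dots> = v i * cnj (v j) * (\<Sum>k<n. v k * cnj (v k))"
      by (simp add: sum_distrib_left mult_ac)
    finally show "(?P * ?P) $$ (i, j) = ?P $$ (i, j)" using assms ij by simp
  qed auto
  ultimately show ?thesis by (simp add: orthogonal_projection_def)
qed

text \<open>Polarisation: the vanishing of the quadratic form of the means on rank-one projections forces the
  means themselves to vanish, first on the diagonal and then, with the vectors \<open>(e\<^sub>a + e\<^sub>b) / sqrt 2\<close>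
  and \<open>(i e\<^sub>a + e\<^sub>b) / sqrt 2\<close>, off the diagonal.\<close>
theorem integration_by_parts:
  assumes FG: "has_gradient n F G" and ab: "a < n" "b < n"
  shows "expectation (G a b) = 0"
proof -
  define g where "g = (\<lambda>i j. expectation (G i j))"
  have quad: "(\<Sum>i<n. v i * (\<Sum>j<n. cnj (v j) * g i j)) = 0"
    if v: "(\<Sum>k<n. v k * cnj (v k)) = 1" for v
  proof -
    let ?P = "mat n n (\<lambda>(i, j). v i * cnj (v j))"
    have int: "integrable \<mu> (G i j)" if "i < n" "j < n" for i j
      using has_gradient_regular'[OF FG that] by (rule regular_integrable)
    have "0 = expectation (\<lambda>M. \<Sum>i<n. \<Sum>j<n. ?P $$ (i, j) * G i j M)"
      using expectation_flow_derivative[OF FG orthogonal_projection_rank_one[OF v]] by simp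
    also have "\<dots> = (\<Sum>i<n. \<Sum>j<n. ?P $$ (i, j) * g i j)"
      unfolding g_def using int
      by (subst Bochner_Integration.integral_sum; (intro Bochner_Integration.integrable_sum)?; simp)+
    also have "\<dots> = (\<Sum>i<n. v i * (\<Sum>j<n. cnj (v j) * g i j))"
      by (auto simp: sum_distrib_left mult_ac intro!: sum.cong)
    finally show ?thesis by simp
  qed
  have diag: "g c c = 0" if "c < n" for c
  proof -
    let ?v = "\<lambda>i. if i = c then 1 else 0 :: complex"
    have "(\<Sum>i<n. ?v i * (\<Sum>j<n. cnj (?v j) * g i j)) = g c c"
      using that by (simp add: if_distrib[of cnj] if_distrib[of "\<lambda>x. x * _"] cong: if_cong)
    moreover have "(\<Sum>k<n. ?v k * cnj (?v k)) = 1"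
      using that by (simp add: if_distrib[of cnj] if_distrib[of "\<lambda>x. x * _"] cong: if_cong)
    ultimately show ?thesis using quad[of ?v] by simp
  qed
  show ?thesis
  proof (cases "a = b")
    case True
    then show ?thesis using diag[OF ab(1)] by (simp add: g_def)
  next
    case False
    have two: "(\<Sum>i<n. (if i = a then x else if i = b then y else 0) * h i) = x * h a + y * h b"
      for x y :: complex and h
    proof -
      have "(\<Sum>i<n. (if i = a then x else if i = b then y else 0) * h i) =
          (\<Sum>i<n. (if i = a then x * h i else 0) + (if i = b then y * h i else 0))"
        using False by (intro sum.cong) auto
      then show ?thesis using ab by (simp add: sum.distrib)
    qed
    have off: "x * cnj y * g a b + y * cnj x * g b a = 0"
      if xy: "x * cnj x + y * cnj y = 1" for x y
    proof -
      let ?v = "\<lambda>i. if i = a then x else if i = b then y else 0"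
      have cv: "cnj (?v j) = (if j = a then cnj x else if j = b then cnj y else 0)" for j by simp
      have "(\<Sum>k<n. ?v k * cnj (?v k)) = 1"
        unfolding two using False xy by simp
      from quad[OF this] show ?thesis
        unfolding cv two using diag ab False by (simp add: algebra_simps)
    qed
    define r where "r = complex_of_real (1 / sqrt 2)"
    have rr: "r * r = 1 / 2" and r: "cnj r = r"
      unfolding r_def by (simp_all flip: of_real_mult)
    have "r * cnj r * g a b + r * cnj r * g b a = 0"
      by (rule off) (simp add: r rr)
    then have sum0: "g a b + g b a = 0"
      unfolding r rr by (simp add: field_simps)
    have "\<i> * r * cnj r * g a b + r * cnj (\<i> * r) * g b a = 0"
      by (rule off) (simp add: r rr algebra_simps)
    then have "\<i> * (r * r) * (g a b - g b a) = 0"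
      by (simp add: r algebra_simps)
    then have "g a b - g b a = 0" unfolding rr by simp
    with sum0 show ?thesis by (simp add: g_def)
  qed
qed

end

section \<open>Power traces and the Schwinger-Dyson equation\<close>

lemma has_gradient_pow_entry:
  assumes "c < n" "d < n"
  shows "has_gradient n (\<lambda>M. (M ^\<^sub>m j) $$ (c, d))
    (\<lambda>a b M. \<Sum>l<j. (M ^\<^sub>m l) $$ (c, a) * (M ^\<^sub>m (j - l)) $$ (b, d))"
  using assms(2)
proof (induction j arbitrary: d)
  case 0
  show ?case
    by (rule has_gradient_cong[OF has_gradient_const[of n "of_bool (c = d)"]])
      (use 0 assms(1) in \<open>auto dest: unitary_carrier\<close>)
next
  case (Suc j)
  have "has_gradient n (\<lambda>M. \<Sum>e<n. (M ^\<^sub>m j) $$ (c, e) * M $$ (e, d))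
     (\<lambda>a b M. \<Sum>e<n. (\<Sum>l<j. (M ^\<^sub>m l) $$ (c, a) * (M ^\<^sub>m (j - l)) $$ (b, e)) * M $$ (e, d)
        + (M ^\<^sub>m j) $$ (c, e) * (if a = e then M $$ (b, d) else 0))"
    using Suc by (intro has_gradient_sum has_gradient_mult has_gradient_entry) auto
  then show ?case
  proof (rule has_gradient_cong)
    fix M assume M: "M \<in> unitary_group n"
    have cM: "M ^\<^sub>m l \<in> carrier_mat n n" "M \<in> carrier_mat n n" for l
      using unitary_carrier[OF M] by auto
    show "(\<Sum>e<n. (M ^\<^sub>m j) $$ (c, e) * M $$ (e, d)) = (M ^\<^sub>m Suc j) $$ (c, d)"
      using mult_mat_entry[OF cM(1,2) assms(1) Suc.prems, of j] by simp
    fix a b assume ab: "a < n" "b < n"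
    have "(\<Sum>e<n. (\<Sum>l<j. (M ^\<^sub>m l) $$ (c, a) * (M ^\<^sub>m (j - l)) $$ (b, e)) * M $$ (e, d))
        = (\<Sum>l<j. \<Sum>e<n. (M ^\<^sub>m l) $$ (c, a) * ((M ^\<^sub>m (j - l)) $$ (b, e) * M $$ (e, d)))"
      unfolding sum_distrib_right by (subst sum.swap) (simp add: mult.assoc)
    also have "\<dots> = (\<Sum>l<j. (M ^\<^sub>m l) $$ (c, a) * (M ^\<^sub>m (Suc j - l)) $$ (b, d))"
    proof (rule sum.cong[OF refl])
      fix l assume "l \<in> {..<j}"
      then have "M ^\<^sub>m (Suc j - l) = M ^\<^sub>m (j - l) * M" by (simp add: Suc_diff_le)
      then show "(\<Sum>e<n. (M ^\<^sub>m l) $$ (c, a) * ((M ^\<^sub>m (j - l)) $$ (b, e) * M $$ (e, d)))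
          = (M ^\<^sub>m l) $$ (c, a) * (M ^\<^sub>m (Suc j - l)) $$ (b, d)"
        by (simp only: sum_distrib_left[symmetric] mult_mat_entry[OF cM(1,2) ab(2) Suc.prems])
    qed
    finally have 1: "(\<Sum>e<n. (\<Sum>l<j. (M ^\<^sub>m l) $$ (c, a) * (M ^\<^sub>m (j - l)) $$ (b, e)) * M $$ (e, d))
        = (\<Sum>l<j. (M ^\<^sub>m l) $$ (c, a) * (M ^\<^sub>m (Suc j - l)) $$ (b, d))" .
    have "(\<Sum>e<n. (M ^\<^sub>m j) $$ (c, e) * (if a = e then M $$ (b, d) else 0)) =
        (\<Sum>e<n. if a = e then (M ^\<^sub>m j) $$ (c, a) * M $$ (b, d) else 0)"
      by (intro sum.cong) auto
    then have 2: "(\<Sum>e<n. (M ^\<^sub>m j) $$ (c, e) * (if a = e then M $$ (b, d) else 0)) =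
        (M ^\<^sub>m j) $$ (c, a) * (M ^\<^sub>m (Suc j - j)) $$ (b, d)"
      using ab unitary_carrier[OF M] by simp
    show "(\<Sum>e<n. (\<Sum>l<j. (M ^\<^sub>m l) $$ (c, a) * (M ^\<^sub>m (j - l)) $$ (b, e)) * M $$ (e, d)
        + (M ^\<^sub>m j) $$ (c, e) * (if a = e then M $$ (b, d) else 0)) =
        (\<Sum>l<Suc j. (M ^\<^sub>m l) $$ (c, a) * (M ^\<^sub>m (Suc j - l)) $$ (b, d))"
      unfolding sum.distrib 1 2 by simp
  qed
qed

definition power_trace :: "nat \<Rightarrow> complex mat \<Rightarrow> complex" where
  "power_trace j M = mat_trace (M ^\<^sub>m j)"

text \<open>The error term of the Schwinger-Dyson equation: differentiating \<open>M^j\<close> splits it at every position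
  into two factors, each of which is closed up to a trace.  The end positions, where one factor is
  the identity, give \<open>n p\<^sub>j\<close> and are left out here.\<close>
definition split_power_trace :: "nat \<Rightarrow> complex mat \<Rightarrow> complex" where
  "split_power_trace j M = (\<Sum>l = 1..<j. power_trace l M * power_trace (j - l) M)"

lemma power_trace_eq:
  "M \<in> carrier_mat n n \<Longrightarrow> power_trace j M = (\<Sum>c<n. (M ^\<^sub>m j) $$ (c, c))"
  by (simp add: power_trace_def mat_trace_def)

lemma sum_power_traces:
  assumes "M \<in> carrier_mat n n" "j \<ge> 1"
  shows "(\<Sum>l<j. power_trace l M * power_trace (j - l) M) =
    of_nat n * power_trace j M + split_power_trace j M"
proof -
  have "{..<j} = insert 0 {1..<j}" using assms(2) by auto
  moreover have "power_trace 0 M = of_nat n"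
    using assms(1) by (simp add: power_trace_eq)
  ultimately show ?thesis by (simp add: split_power_trace_def)
qed

lemma pow_contraction:
  fixes M :: "complex mat"
  assumes "M \<in> carrier_mat n n" "a < n" "b < n"
  shows "(\<Sum>c<n. (M ^\<^sub>m k) $$ (a, c) * (M ^\<^sub>m l) $$ (c, b)) = (M ^\<^sub>m (k + l)) $$ (a, b)"
  using mult_mat_entry[of "M ^\<^sub>m k" n "M ^\<^sub>m l" a b] pow_mat_add_exp[OF assms(1)] assms by simp

text \<open>In the trace all \<open>j\<close> terms of the product rule coincide by cyclicity.\<close>
lemma has_gradient_power_trace:
  "has_gradient n (power_trace j) (\<lambda>a b M. of_nat j * (M ^\<^sub>m j) $$ (b, a))"
proof -
  have "has_gradient n (\<lambda>M. \<Sum>c<n. (M ^\<^sub>m j) $$ (c, c))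
     (\<lambda>a b M. \<Sum>c<n. \<Sum>l<j. (M ^\<^sub>m l) $$ (c, a) * (M ^\<^sub>m (j - l)) $$ (b, c))"
    by (intro has_gradient_sum has_gradient_pow_entry) auto
  then show ?thesis
  proof (rule has_gradient_cong)
    fix M assume M: "M \<in> unitary_group n"
    show "(\<Sum>c<n. (M ^\<^sub>m j) $$ (c, c)) = power_trace j M"
      using power_trace_eq[OF unitary_carrier[OF M]] by simp
    fix a b assume ab: "a < n" "b < n"
    have "(\<Sum>c<n. \<Sum>l<j. (M ^\<^sub>m l) $$ (c, a) * (M ^\<^sub>m (j - l)) $$ (b, c)) =
       (\<Sum>l<j. \<Sum>c<n. (M ^\<^sub>m (j - l)) $$ (b, c) * (M ^\<^sub>m l) $$ (c, a))"
      by (subst sum.swap) (simp add: mult.commute)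
    also have "\<dots> = (\<Sum>l<j. (M ^\<^sub>m j) $$ (b, a))"
      by (intro sum.cong) (auto simp: pow_contraction[OF unitary_carrier[OF M] ab(2,1)])
    finally show "(\<Sum>c<n. \<Sum>l<j. (M ^\<^sub>m l) $$ (c, a) * (M ^\<^sub>m (j - l)) $$ (b, c)) =
       of_nat j * (M ^\<^sub>m j) $$ (b, a)" by simp
  qed
qed

lemma regular_power_trace: "regular n (power_trace j)"
  by (rule has_gradient_regular[OF has_gradient_power_trace])

lemma regular_split_power_trace: "regular n (split_power_trace j)"
  unfolding split_power_trace_def[abs_def] by (intro regular_sum regular_mult regular_power_trace)

context haar_unitary
begin

text \<open>Integration by parts in the direction \<open>E\<^sub>a\<^sub>b\<close> for the function \<open>(M^j)\<^sub>a\<^sub>b F\<close>, summed over \<open>a\<close> and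
  \<open>b\<close>.\<close>
theorem schwinger_dyson:
  assumes FG: "has_gradient n F G" and j: "j \<ge> 1"
  shows "expectation (\<lambda>M. (of_nat n * power_trace j M + split_power_trace j M) * F M)
    + expectation (\<lambda>M. \<Sum>a<n. \<Sum>b<n. (M ^\<^sub>m j) $$ (a, b) * G a b M) = 0"
proof -
  define Q where "Q = (\<lambda>a b M. (\<Sum>l<j. (M ^\<^sub>m l) $$ (a, a) * (M ^\<^sub>m (j - l)) $$ (b, b)) * F M
      + (M ^\<^sub>m j) $$ (a, b) * G a b M)"
  have grad: "has_gradient n (\<lambda>M. (M ^\<^sub>m j) $$ (a, b) * F M)
      (\<lambda>a' b' M. (\<Sum>l<j. (M ^\<^sub>m l) $$ (a, a') * (M ^\<^sub>m (j - l)) $$ (b', b)) * F M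
        + (M ^\<^sub>m j) $$ (a, b) * G a' b' M)" if "a < n" "b < n" for a b
    using that by (intro has_gradient_mult has_gradient_pow_entry FG)
  have Q0: "expectation (Q a b) = 0" and Qr: "regular n (Q a b)" if "a < n" "b < n" for a b
    unfolding Q_def
    using integration_by_parts[OF grad[OF that] that] has_gradient_regular'[OF grad[OF that] that] .
  have rp: "regular n (\<lambda>M. (M ^\<^sub>m j) $$ (a, b))" if "a < n" "b < n" for a b
    by (rule has_gradient_regular[OF has_gradient_pow_entry[OF that]])
  have r1: "regular n (\<lambda>M. (of_nat n * power_trace j M + split_power_trace j M) * F M)"
    by (intro regular_mult regular_add regular_const regular_power_trace regular_split_power_trace
        has_gradient_regular[OF FG])
  have r2: "regular n (\<lambda>M. \<Sum>a<n. \<Sum>b<n. (M ^\<^sub>m j) $$ (a, b) * G a b M)"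
    by (intro regular_sum regular_mult rp has_gradient_regular'[OF FG]) auto
  have "expectation (\<lambda>M. \<Sum>a<n. \<Sum>b<n. Q a b M) = (\<Sum>a<n. expectation (\<lambda>M. \<Sum>b<n. Q a b M))"
    by (rule Bochner_Integration.integral_sum) (intro regular_integrable regular_sum Qr; simp)
  also have "\<dots> = (\<Sum>a<n. \<Sum>b<n. expectation (Q a b))"
    by (intro sum.cong refl Bochner_Integration.integral_sum) (intro regular_integrable Qr; simp)
  also have "\<dots> = 0" by (simp add: Q0)
  finally have "0 = expectation (\<lambda>M. \<Sum>a<n. \<Sum>b<n. Q a b M)" by simp
  also have "\<dots> = expectation (\<lambda>M. (of_nat n * power_trace j M + split_power_trace j M) * F M
      + (\<Sum>a<n. \<Sum>b<n. (M ^\<^sub>m j) $$ (a, b) * G a b M))"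
  proof (rule Bochner_Integration.integral_cong[OF refl])
    fix M assume "M \<in> space \<mu>"
    then have M: "M \<in> carrier_mat n n" by (simp add: unitary_carrier)
    have "(\<Sum>a<n. \<Sum>b<n. \<Sum>l<j. (M ^\<^sub>m l) $$ (a, a) * (M ^\<^sub>m (j - l)) $$ (b, b)) =
        (\<Sum>l<j. \<Sum>a<n. \<Sum>b<n. (M ^\<^sub>m l) $$ (a, a) * (M ^\<^sub>m (j - l)) $$ (b, b))"
      by (subst sum.swap[of _ "{..<j}"]) (simp add: sum.swap[of _ "{..<j}"])
    also have "\<dots> = (\<Sum>l<j. power_trace l M * power_trace (j - l) M)"
      by (simp add: power_trace_eq[OF M] sum_product)
    also have "\<dots> = of_nat n * power_trace j M + split_power_trace j M"
      by (rule sum_power_traces[OF M j])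
    finally show "(\<Sum>a<n. \<Sum>b<n. Q a b M) =
        (of_nat n * power_trace j M + split_power_trace j M) * F M
         + (\<Sum>a<n. \<Sum>b<n. (M ^\<^sub>m j) $$ (a, b) * G a b M)"
      by (simp add: Q_def sum.distrib sum_distrib_right[symmetric])
  qed
  also have "\<dots> = expectation (\<lambda>M. (of_nat n * power_trace j M + split_power_trace j M) * F M)
    + expectation (\<lambda>M. \<Sum>a<n. \<Sum>b<n. (M ^\<^sub>m j) $$ (a, b) * G a b M)"
    by (intro Bochner_Integration.integral_add regular_integrable r1 r2)
  finally show ?thesis by simp
qed

text \<open>The Schwinger-Dyson equation for the conjugate of \<open>p\<^sub>j\<close>, whose gradient contracts with \<open>M^j\<close> to the
  squared Hilbert-Schmidt norm of the unitary matrix \<open>M^j\<close>, that is to \<open>n\<close>.\<close>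
lemma power_trace_second_moment_identity:
  assumes "j \<ge> 1"
  shows "expectation (\<lambda>M. (of_nat n * power_trace j M + split_power_trace j M) * cnj (power_trace j M))
    = of_nat (j * n)"
proof -
  have "expectation (\<lambda>M. \<Sum>a<n. \<Sum>b<n. (M ^\<^sub>m j) $$ (a, b) * - cnj (of_nat j * (M ^\<^sub>m j) $$ (a, b)))
     = expectation (\<lambda>M. - of_nat (j * n))"
  proof (rule Bochner_Integration.integral_cong[OF refl])
    fix M assume "M \<in> space \<mu>"
    then have M: "M ^\<^sub>m j \<in> unitary_group n" by (simp add: unitary_pow)
    have "(\<Sum>a<n. \<Sum>b<n. (M ^\<^sub>m j) $$ (a, b) * - cnj (of_nat j * (M ^\<^sub>m j) $$ (a, b))) =
        - of_nat j * (\<Sum>a<n. \<Sum>b<n. (M ^\<^sub>m j) $$ (a, b) * cnj ((M ^\<^sub>m j) $$ (a, b)))"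
      by (simp add: sum_distrib_left sum_negf mult_ac)
    also have "\<dots> = - of_nat j * (\<Sum>a<n. 1)"
      using unitary_row_norm[OF M] by simp
    finally show "(\<Sum>a<n. \<Sum>b<n. (M ^\<^sub>m j) $$ (a, b) * - cnj (of_nat j * (M ^\<^sub>m j) $$ (a, b))) =
       - of_nat (j * n)" by simp
  qed
  then show ?thesis
    using schwinger_dyson[OF has_gradient_cnj[OF has_gradient_power_trace] assms, of j]
    by (simp add: prob_space)
qed

end

section \<open>The Laplacian on monomials in the entries\<close>

text \<open>The operator \<open>\<Sum> D\<^sub>b\<^sub>a D\<^sub>a\<^sub>b\<close> is the (nonnegative) Laplace-Beltrami operator of the unitary group for
  the trace inner product.  It is kept as a relation to a witness \<open>L\<close>, so that two formulas for the
  same Laplacian need not be compared.\<close>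
definition has_laplacian :: "nat \<Rightarrow> (complex mat \<Rightarrow> complex) \<Rightarrow> (complex mat \<Rightarrow> complex) \<Rightarrow> bool" where
  "has_laplacian n F L \<longleftrightarrow> (\<exists>G H. has_gradient n F G \<and>
     (\<forall>a<n. \<forall>b<n. has_gradient n (G a b) (H a b)) \<and>
     (\<forall>M\<in>unitary_group n. L M = (\<Sum>a<n. \<Sum>b<n. H a b b a M)))"

lemma has_laplacianI:
  assumes "has_gradient n F G" "\<And>a b. a < n \<Longrightarrow> b < n \<Longrightarrow> has_gradient n (G a b) (H a b)"
    and "\<And>M. M \<in> unitary_group n \<Longrightarrow> L M = (\<Sum>a<n. \<Sum>b<n. H a b b a M)"
  shows "has_laplacian n F L"
  using assms unfolding has_laplacian_def by blast

lemma has_laplacianE: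
  assumes "has_laplacian n F L"
  obtains G H where "has_gradient n F G" "\<And>a b. a < n \<Longrightarrow> b < n \<Longrightarrow> has_gradient n (G a b) (H a b)"
    and "\<And>M. M \<in> unitary_group n \<Longrightarrow> L M = (\<Sum>a<n. \<Sum>b<n. H a b b a M)"
  using assms unfolding has_laplacian_def by blast

lemma has_laplacian_regular:
  assumes "has_laplacian n F L"
  shows "regular n F" "regular n L"
proof -
  obtain G H where GH: "has_gradient n F G" "\<And>a b. a < n \<Longrightarrow> b < n \<Longrightarrow> has_gradient n (G a b) (H a b)"
    and L: "\<And>M. M \<in> unitary_group n \<Longrightarrow> L M = (\<Sum>a<n. \<Sum>b<n. H a b b a M)"
    using has_laplacianE[OF assms] by blast
  show "regular n F" by (rule has_gradient_regular[OF GH(1)])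
  have "regular n (\<lambda>M. \<Sum>a<n. \<Sum>b<n. H a b b a M)"
    by (intro regular_sum has_gradient_regular'[OF GH(2)]) auto
  then show "regular n L" by (rule regular_cong) (simp add: L)
qed

lemma has_laplacian_cong:
  assumes "has_laplacian n F L"
    and F: "\<And>M. M \<in> unitary_group n \<Longrightarrow> F M = F' M"
    and L': "\<And>M. M \<in> unitary_group n \<Longrightarrow> L M = L' M"
  shows "has_laplacian n F' L'"
proof -
  obtain G H where GH: "has_gradient n F G" "\<And>a b. a < n \<Longrightarrow> b < n \<Longrightarrow> has_gradient n (G a b) (H a b)"
    and L: "\<And>M. M \<in> unitary_group n \<Longrightarrow> L M = (\<Sum>a<n. \<Sum>b<n. H a b b a M)"
    using has_laplacianE[OF assms(1)] by blast
  show ?thesis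
  proof (rule has_laplacianI)
    show "has_gradient n F' G" by (rule has_gradient_cong[OF GH(1) F]) auto
    show "has_gradient n (G a b) (H a b)" if "a < n" "b < n" for a b using that by (rule GH(2))
    show "L' M = (\<Sum>a<n. \<Sum>b<n. H a b b a M)" if "M \<in> unitary_group n" for M
      using L'[OF that] L[OF that] by simp
  qed
qed

lemma has_laplacian_add:
  assumes "has_laplacian n F L" "has_laplacian n F' L'"
  shows "has_laplacian n (\<lambda>M. F M + F' M) (\<lambda>M. L M + L' M)"
proof -
  obtain G H where GH: "has_gradient n F G" "\<And>a b. a < n \<Longrightarrow> b < n \<Longrightarrow> has_gradient n (G a b) (H a b)"
    and L: "\<And>M. M \<in> unitary_group n \<Longrightarrow> L M = (\<Sum>a<n. \<Sum>b<n. H a b b a M)"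
    using has_laplacianE[OF assms(1)] by blast
  obtain G' H' where GH': "has_gradient n F' G'" "\<And>a b. a < n \<Longrightarrow> b < n \<Longrightarrow> has_gradient n (G' a b) (H' a b)"
    and L': "\<And>M. M \<in> unitary_group n \<Longrightarrow> L' M = (\<Sum>a<n. \<Sum>b<n. H' a b b a M)"
    using has_laplacianE[OF assms(2)] by blast
  show ?thesis
  proof (rule has_laplacianI[OF has_gradient_add[OF GH(1) GH'(1)]])
    show "has_gradient n (\<lambda>M. G a b M + G' a b M) (\<lambda>a' b' M. H a b a' b' M + H' a b a' b' M)"
      if "a < n" "b < n" for a b
      using has_gradient_add[OF GH(2)[OF that] GH'(2)[OF that]] .
  qed (simp add: L L' sum.distrib)
qed

lemma has_laplacian_cmult:
  assumes "has_laplacian n F L"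
  shows "has_laplacian n (\<lambda>M. z * F M) (\<lambda>M. z * L M)"
proof -
  obtain G H where GH: "has_gradient n F G" "\<And>a b. a < n \<Longrightarrow> b < n \<Longrightarrow> has_gradient n (G a b) (H a b)"
    and L: "\<And>M. M \<in> unitary_group n \<Longrightarrow> L M = (\<Sum>a<n. \<Sum>b<n. H a b b a M)"
    using has_laplacianE[OF assms(1)] by blast
  show ?thesis
  proof (rule has_laplacianI[OF has_gradient_cmult[OF GH(1)]])
    show "has_gradient n (\<lambda>M. z * G a b M) (\<lambda>a' b' M. z * H a b a' b' M)" if "a < n" "b < n" for a b
      using has_gradient_cmult[OF GH(2)[OF that]] .
  qed (simp add: L sum_distrib_left)
qed

lemma has_laplacian_zero: "has_laplacian n (\<lambda>M. 0) (\<lambda>M. 0)"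
  by (rule has_laplacianI[OF has_gradient_const has_gradient_const]) simp

lemma has_laplacian_power_trace:
  assumes "j \<ge> 1"
  shows "has_laplacian n (power_trace j)
    (\<lambda>M. of_nat (n * j) * power_trace j M + of_nat j * split_power_trace j M)"
proof (rule has_laplacianI[OF has_gradient_power_trace])
  show "has_gradient n (\<lambda>M. of_nat j * (M ^\<^sub>m j) $$ (b, a))
      (\<lambda>a' b' M. of_nat j * (\<Sum>l<j. (M ^\<^sub>m l) $$ (b, a') * (M ^\<^sub>m (j - l)) $$ (b', a)))"
    if "a < n" "b < n" for a b
    using that by (intro has_gradient_cmult has_gradient_pow_entry)
  fix M assume "M \<in> unitary_group n"
  then have M: "M \<in> carrier_mat n n" by (rule unitary_carrier)
  have "(\<Sum>a<n. \<Sum>b<n. \<Sum>l<j. (M ^\<^sub>m l) $$ (b, b) * (M ^\<^sub>m (j - l)) $$ (a, a)) =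
      (\<Sum>l<j. \<Sum>a<n. \<Sum>b<n. (M ^\<^sub>m l) $$ (b, b) * (M ^\<^sub>m (j - l)) $$ (a, a))"
    by (subst sum.swap[of _ "{..<j}"]) (simp add: sum.swap[of _ "{..<j}"])
  also have "\<dots> = (\<Sum>l<j. power_trace l M * power_trace (j - l) M)"
  proof (rule sum.cong[OF refl])
    fix l
    have "power_trace l M * power_trace (j - l) M =
        (\<Sum>b<n. \<Sum>a<n. (M ^\<^sub>m l) $$ (b, b) * (M ^\<^sub>m (j - l)) $$ (a, a))"
      by (simp add: power_trace_eq[OF M] sum_product)
    also have "\<dots> = (\<Sum>a<n. \<Sum>b<n. (M ^\<^sub>m l) $$ (b, b) * (M ^\<^sub>m (j - l)) $$ (a, a))"
      by (rule sum.swap)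
    finally show "(\<Sum>a<n. \<Sum>b<n. (M ^\<^sub>m l) $$ (b, b) * (M ^\<^sub>m (j - l)) $$ (a, a)) =
        power_trace l M * power_trace (j - l) M" by simp
  qed
  also have "\<dots> = of_nat n * power_trace j M + split_power_trace j M"
    by (rule sum_power_traces[OF M assms])
  finally show "of_nat (n * j) * power_trace j M + of_nat j * split_power_trace j M =
      (\<Sum>a<n. \<Sum>b<n. of_nat j * (\<Sum>l<j. (M ^\<^sub>m l) $$ (b, b) * (M ^\<^sub>m (j - l)) $$ (a, a)))"
    by (simp add: sum_distrib_left[symmetric] algebra_simps)
qed

definition monomial :: "(nat \<times> nat) list \<Rightarrow> complex mat \<Rightarrow> complex" where
  "monomial ps M = prod_list (map (\<lambda>p. M $$ p) ps)"

lemma monomial_Nil [simp]: "monomial [] M = 1"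
  and monomial_Cons [simp]: "monomial (p # ps) M = M $$ p * monomial ps M"
  and monomial_append: "monomial (ps @ qs) M = monomial ps M * monomial qs M"
  by (simp_all add: monomial_def)

definition set_row :: "nat \<Rightarrow> nat \<Rightarrow> (nat \<times> nat) list \<Rightarrow> (nat \<times> nat) list" where
  "set_row i b ps = ps[i := (b, snd (ps ! i))]"

lemma length_set_row [simp]: "length (set_row i b ps) = length ps"
  by (simp add: set_row_def)

lemma set_row_range:
  assumes "set ps \<subseteq> {..<n} \<times> {..<n}" "i < length ps" "b < n"
  shows "set (set_row i b ps) \<subseteq> {..<n} \<times> {..<n}"
proof -
  have "snd (ps ! i) < n" using assms(1) nth_mem[OF assms(2)] by auto
  then show ?thesis
    using assms set_update_subset_insert[of ps i "(b, snd (ps ! i))"] by (auto simp: set_row_def)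
qed

lemma has_gradient_monomial:
  assumes "set ps \<subseteq> {..<n} \<times> {..<n}"
  shows "has_gradient n (monomial ps)
    (\<lambda>a b M. \<Sum>i<length ps. if fst (ps ! i) = a then monomial (set_row i b ps) M else 0)"
  using assms
proof (induction ps)
  case Nil
  have "monomial [] = (\<lambda>M. 1)" by (simp add: fun_eq_iff)
  then show ?case using has_gradient_const[of n 1] by simp
next
  case (Cons p ps)
  obtain c d where p: "p = (c, d)" "c < n" "d < n" using Cons.prems by auto
  have "has_gradient n (\<lambda>M. M $$ (c, d) * monomial ps M)
     (\<lambda>a b M. (if a = c then M $$ (b, d) else 0) * monomial ps M + M $$ (c, d) *
       (\<Sum>i<length ps. if fst (ps ! i) = a then monomial (set_row i b ps) M else 0))"
    using Cons p by (intro has_gradient_mult has_gradient_entry) auto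
  then show ?case
    by (rule has_gradient_cong)
      (auto simp: p set_row_def sum.lessThan_Suc_shift sum_distrib_left intro!: sum.cong
        simp del: sum.lessThan_Suc)
qed

definition swap_rows :: "nat \<Rightarrow> nat \<Rightarrow> (nat \<times> nat) list \<Rightarrow> (nat \<times> nat) list" where
  "swap_rows i i' ps = set_row i' (fst (ps ! i)) (set_row i (fst (ps ! i')) ps)"

lemma length_swap_rows [simp]: "length (swap_rows i i' ps) = length ps"
  by (simp add: swap_rows_def)

lemma swap_rows_range:
  assumes "set ps \<subseteq> {..<n} \<times> {..<n}" "i < length ps" "i' < length ps"
  shows "set (swap_rows i i' ps) \<subseteq> {..<n} \<times> {..<n}"
proof -
  have "fst (ps ! i) < n" "fst (ps ! i') < n"
    using assms(1) nth_mem[OF assms(2)] nth_mem[OF assms(3)] by auto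
  then show ?thesis
    unfolding swap_rows_def using assms by (intro set_row_range) auto
qed

text \<open>\<open>D\<^sub>a\<^sub>b\<close> replaces one row index \<open>a\<close> by \<open>b\<close>, and \<open>D\<^sub>b\<^sub>a\<close> then replaces one row index \<open>b\<close> by \<open>a\<close>.  If both
  act on the same factor, it is restored, once for each of the \<open>n\<close> values of \<open>b\<close>.  If they act on
  different factors, the two row indices have been exchanged.\<close>
lemma has_laplacian_monomial:
  assumes ps: "set ps \<subseteq> {..<n} \<times> {..<n}" and k: "length ps = k"
  shows "has_laplacian n (monomial ps) (\<lambda>M. of_nat (n * k) * monomial ps M +
    (\<Sum>i<k. \<Sum>i'\<in>{..<k} - {i}. monomial (swap_rows i i' ps) M))"
proof (rule has_laplacianI[OF has_gradient_monomial[OF ps]])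
  show "has_gradient n (\<lambda>M. \<Sum>i<length ps. if fst (ps ! i) = a then monomial (set_row i b ps) M else 0)
     (\<lambda>a' b' M. \<Sum>i<k. if fst (ps ! i) = a then
        \<Sum>i'<k. if fst (set_row i b ps ! i') = a' then monomial (set_row i' b' (set_row i b ps)) M else 0
        else 0)" if "a < n" "b < n" for a b
    unfolding k
  proof (rule has_gradient_sum)
    fix i assume "i \<in> {..<k}"
    then have "has_gradient n (monomial (set_row i b ps)) (\<lambda>a' b' M.
        \<Sum>i'<k. if fst (set_row i b ps ! i') = a' then monomial (set_row i' b' (set_row i b ps)) M else 0)"
      using has_gradient_monomial[OF set_row_range[OF ps _ that(2)], of i] k by simp
    then show "has_gradient n (\<lambda>M. if fst (ps ! i) = a then monomial (set_row i b ps) M else 0)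
      (\<lambda>a' b' M. if fst (ps ! i) = a then
        \<Sum>i'<k. if fst (set_row i b ps ! i') = a' then monomial (set_row i' b' (set_row i b ps)) M else 0
        else 0)"
      by (cases "fst (ps ! i) = a") (simp_all add: has_gradient_const)
  qed
  fix M assume "M \<in> unitary_group n"
  define T where "T = (\<lambda>i b i'. if fst (set_row i b ps ! i') = b
      then monomial (set_row i' (fst (ps ! i)) (set_row i b ps)) M else 0)"
  have row: "fst (ps ! i) < n" if "i < k" for i
    using subsetD[OF ps nth_mem[of i ps]] that k by auto
  have "(\<Sum>a<n. \<Sum>b<n. \<Sum>i<k. if fst (ps ! i) = a then
        \<Sum>i'<k. if fst (set_row i b ps ! i') = b then monomial (set_row i' a (set_row i b ps)) M else 0
        else 0) = (\<Sum>a<n. \<Sum>b<n. \<Sum>i<k. if fst (ps ! i) = a then (\<Sum>i'<k. T i b i') else 0)"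
    unfolding T_def by (intro sum.cong) auto
  also have "\<dots> = (\<Sum>i<k. \<Sum>a<n. \<Sum>b<n. if fst (ps ! i) = a then (\<Sum>i'<k. T i b i') else 0)"
    by (subst sum.swap[of _ "{..<k}"]) (simp add: sum.swap[of _ "{..<k}"])
  also have "\<dots> = (\<Sum>i<k. \<Sum>a<n. if fst (ps ! i) = a then (\<Sum>b<n. \<Sum>i'<k. T i b i') else 0)"
    by (intro sum.cong refl) simp
  also have "\<dots> = (\<Sum>i<k. \<Sum>b<n. \<Sum>i'<k. T i b i')"
    by (rule sum.cong[OF refl]) (simp add: row)
  also have "\<dots> = (\<Sum>i<k. of_nat n * monomial ps M + (\<Sum>i'\<in>{..<k} - {i}. monomial (swap_rows i i' ps) M))"
  proof (rule sum.cong[OF refl])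
    fix i assume i: "i \<in> {..<k}"
    have same: "T i b i = monomial ps M" for b
      using i k by (simp add: T_def set_row_def)
    have other: "(\<Sum>b<n. T i b i') = monomial (swap_rows i i' ps) M" if i': "i' \<in> {..<k} - {i}" for i'
    proof -
      have "T i b i' = (if fst (ps ! i') = b then monomial (swap_rows i i' ps) M else 0)" for b
        using i i' k by (auto simp: T_def set_row_def swap_rows_def)
      then show ?thesis using row[of i'] i' by simp
    qed
    have "(\<Sum>b<n. \<Sum>i'<k. T i b i') = (\<Sum>i'<k. \<Sum>b<n. T i b i')" by (rule sum.swap)
    also have "\<dots> = (\<Sum>b<n. T i b i) + (\<Sum>i'\<in>{..<k} - {i}. \<Sum>b<n. T i b i')"
      using i by (intro sum.remove) auto
    finally show "(\<Sum>b<n. \<Sum>i'<k. T i b i') =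
        of_nat n * monomial ps M + (\<Sum>i'\<in>{..<k} - {i}. monomial (swap_rows i i' ps) M)"
      by (simp add: same other)
  qed
  also have "\<dots> = of_nat (n * k) * monomial ps M +
      (\<Sum>i<k. \<Sum>i'\<in>{..<k} - {i}. monomial (swap_rows i i' ps) M)"
    by (simp add: sum.distrib algebra_simps)
  finally show "of_nat (n * k) * monomial ps M +
      (\<Sum>i<k. \<Sum>i'\<in>{..<k} - {i}. monomial (swap_rows i i' ps) M) =
      (\<Sum>a<n. \<Sum>b<n. \<Sum>i<k. if fst (ps ! i) = a then
        \<Sum>i'<k. if fst (set_row i b ps ! i') = b then monomial (set_row i' a (set_row i b ps)) M else 0
        else 0)" by simp
qed

section \<open>Homogeneous polynomials\<close>

text \<open>Linear combinations of monomials of degree \<open>k\<close>.  The real parameter is the sum of the absolute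
  values of the coefficients in some representation; it bounds the supremum norm and is what the
  Laplacian can be seen to multiply by at most \<open>k(k-1)\<close>.\<close>
inductive homogeneous :: "nat \<Rightarrow> nat \<Rightarrow> real \<Rightarrow> (complex mat \<Rightarrow> complex) \<Rightarrow> bool" for n k where
  zero: "homogeneous n k 0 (\<lambda>M. 0)"
| monomial: "set ps \<subseteq> {..<n} \<times> {..<n} \<Longrightarrow> length ps = k \<Longrightarrow> homogeneous n k 1 (monomial ps)"
| add: "homogeneous n k c F \<Longrightarrow> homogeneous n k d G \<Longrightarrow> homogeneous n k (c + d) (\<lambda>M. F M + G M)"
| scale: "homogeneous n k c F \<Longrightarrow> homogeneous n k (norm z * c) (\<lambda>M. z * F M)"
| cong: "homogeneous n k c F \<Longrightarrow> (\<And>M. M \<in> unitary_group n \<Longrightarrow> F M = G M) \<Longrightarrow> homogeneous n k c G"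

lemma homogeneous_sum:
  assumes "finite I" "\<And>i. i \<in> I \<Longrightarrow> homogeneous n k (c i) (F i)"
  shows "homogeneous n k (\<Sum>i\<in>I. c i) (\<lambda>M. \<Sum>i\<in>I. F i M)"
  using assms
proof (induction I rule: finite_induct)
  case empty
  then show ?case using homogeneous.zero by simp
next
  case (insert i I)
  then show ?case using homogeneous.add[of n k "c i" "F i"] by simp
qed

lemma homogeneous_bound:
  "homogeneous n k c F \<Longrightarrow> M \<in> unitary_group n \<Longrightarrow> norm (F M) \<le> c"
proof (induction rule: homogeneous.induct)
  case (monomial ps)
  have "set ps \<subseteq> {..<n} \<times> {..<n} \<Longrightarrow> norm (monomial ps M) \<le> 1"
  proof (induction ps)
    case (Cons p ps)
    obtain c d where p: "p = (c, d)" "c < n" "d < n" using Cons.prems by auto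
    then have "norm (M $$ p) \<le> 1" using unitary_entry_norm_le[OF \<open>M \<in> unitary_group n\<close>] by simp
    then show ?case using Cons by (simp add: norm_mult mult_le_one)
  qed simp
  then show ?case using monomial by blast
next
  case (add c F d G)
  then show ?case by (auto intro!: norm_triangle_le)
next
  case (scale c F z)
  then show ?case by (auto simp: norm_mult intro!: mult_left_mono)
qed auto

lemma homogeneous_mult:
  assumes "homogeneous n k c F" "homogeneous n l d G"
  shows "homogeneous n (k + l) (c * d) (\<lambda>M. F M * G M)"
  using assms(1)
proof (induction rule: homogeneous.induct)
  case zero
  then show ?case using homogeneous.zero by simp
next
  case (monomial ps)
  have "homogeneous n (k + l) d (\<lambda>M. monomial ps M * G M)"
    using assms(2)
  proof (induction rule: homogeneous.induct)
    case zero
    then show ?case using homogeneous.zero by simp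
  next
    case (monomial qs)
    have "(\<lambda>M. monomial ps M * monomial qs M) = monomial (ps @ qs)"
      by (simp add: fun_eq_iff monomial_append)
    then show ?case
      using monomial \<open>set ps \<subseteq> _\<close> \<open>length ps = k\<close> homogeneous.monomial[of "ps @ qs" n "k + l"] by simp
  next
    case (add c F d G)
    then show ?case
      using homogeneous.add[OF add.IH] by (simp add: distrib_left)
  next
    case (scale c F z)
    then show ?case
      using homogeneous.scale[OF scale.IH, of z] by (simp add: mult.left_commute)
  next
    case (cong c F G)
    then show ?case by (intro homogeneous.cong[OF cong.IH]) simp
  qed
  then show ?case by simp
next
  case (add c F d G)
  then show ?case
    using homogeneous.add[OF add.IH] by (simp add: distrib_right)
next
  case (scale c F z)
  then show ?case
    using homogeneous.scale[OF scale.IH, of z] by (simp add: mult.assoc)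
next
  case (cong c F G)
  then show ?case by (intro homogeneous.cong[OF cong.IH]) simp
qed

text \<open>Each of the \<open>k(k-1)\<close> exchanges of row indices takes a monomial to a monomial.\<close>
lemma homogeneous_laplacian:
  assumes "homogeneous n k c F"
  shows "\<exists>K. homogeneous n k (real (k * (k - 1)) * c) K \<and>
    has_laplacian n F (\<lambda>M. of_nat (n * k) * F M + K M)"
  using assms
proof (induction rule: homogeneous.induct)
  case zero
  show ?case
    by (rule exI[of _ "\<lambda>M. 0"]) (simp add: homogeneous.zero has_laplacian_zero)
next
  case (monomial ps)
  have "homogeneous n k (\<Sum>i<k. \<Sum>i'\<in>{..<k} - {i}. 1)
      (\<lambda>M. \<Sum>i<k. \<Sum>i'\<in>{..<k} - {i}. monomial (swap_rows i i' ps) M)"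
    using monomial by (intro homogeneous_sum homogeneous.monomial swap_rows_range) auto
  moreover have "(\<Sum>i<k. \<Sum>i'\<in>{..<k} - {i}. 1 :: real) = real (k * (k - 1)) * 1"
    by (cases k) (simp_all add: algebra_simps)
  ultimately have "homogeneous n k (real (k * (k - 1)) * 1)
      (\<lambda>M. \<Sum>i<k. \<Sum>i'\<in>{..<k} - {i}. monomial (swap_rows i i' ps) M)"
    by (simp only:)
  then show ?case using has_laplacian_monomial[OF monomial] by blast
next
  case (add c F d G)
  then obtain K K' where K: "homogeneous n k (real (k * (k - 1)) * c) K"
      "has_laplacian n F (\<lambda>M. of_nat (n * k) * F M + K M)"
    and K': "homogeneous n k (real (k * (k - 1)) * d) K'"
      "has_laplacian n G (\<lambda>M. of_nat (n * k) * G M + K' M)" by blast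
  have "homogeneous n k (real (k * (k - 1)) * (c + d)) (\<lambda>M. K M + K' M)"
    using homogeneous.add[OF K(1) K'(1)] by (simp only: distrib_left)
  moreover have "has_laplacian n (\<lambda>M. F M + G M)
      (\<lambda>M. of_nat (n * k) * (F M + G M) + (K M + K' M))"
    by (rule has_laplacian_cong[OF has_laplacian_add[OF K(2) K'(2)]]) (simp_all add: algebra_simps)
  ultimately show ?case by blast
next
  case (scale c F z)
  then obtain K where K: "homogeneous n k (real (k * (k - 1)) * c) K"
      "has_laplacian n F (\<lambda>M. of_nat (n * k) * F M + K M)" by blast
  have "homogeneous n k (real (k * (k - 1)) * (norm z * c)) (\<lambda>M. z * K M)"
    using homogeneous.scale[OF K(1), of z] by (simp only: mult.left_commute)
  moreover have "has_laplacian n (\<lambda>M. z * F M) (\<lambda>M. of_nat (n * k) * (z * F M) + z * K M)"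
    by (rule has_laplacian_cong[OF has_laplacian_cmult[OF K(2)], of z]) (simp_all add: algebra_simps)
  ultimately show ?case by blast
next
  case (cong c F G)
  then obtain K where K: "homogeneous n k (real (k * (k - 1)) * c) K"
      "has_laplacian n F (\<lambda>M. of_nat (n * k) * F M + K M)" by blast
  have "has_laplacian n G (\<lambda>M. of_nat (n * k) * G M + K M)"
    by (rule has_laplacian_cong[OF K(2)]) (simp_all add: cong)
  with K(1) show ?case by blast
qed

lemma homogeneous_pow_entry:
  assumes "a < n" "b < n"
  shows "\<exists>c. homogeneous n j c (\<lambda>M. (M ^\<^sub>m j) $$ (a, b))"
  using assms(2)
proof (induction j arbitrary: b)
  case 0
  have "homogeneous n 0 (norm (of_bool (a = b) :: complex) * 1) (\<lambda>M. of_bool (a = b) * monomial [] M)"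
    by (intro homogeneous.scale homogeneous.monomial) auto
  then have "homogeneous n 0 (norm (of_bool (a = b) :: complex) * 1) (\<lambda>M. (M ^\<^sub>m 0) $$ (a, b))"
    by (rule homogeneous.cong) (use 0 assms(1) in \<open>auto dest: unitary_carrier\<close>)
  then show ?case by blast
next
  case (Suc j)
  then have "\<forall>e. \<exists>c. e < n \<longrightarrow> homogeneous n j c (\<lambda>M. (M ^\<^sub>m j) $$ (a, e))" by blast
  from choice[OF this]
  obtain c where c: "\<And>e. e < n \<Longrightarrow> homogeneous n j (c e) (\<lambda>M. (M ^\<^sub>m j) $$ (a, e))" by blast
  have "homogeneous n (j + 1) (\<Sum>e<n. c e * 1) (\<lambda>M. \<Sum>e<n. (M ^\<^sub>m j) $$ (a, e) * monomial [(e, b)] M)"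
    using Suc.prems
    by (intro homogeneous_sum homogeneous_mult homogeneous.monomial c) auto
  then have "homogeneous n (Suc j) (\<Sum>e<n. c e * 1) (\<lambda>M. (M ^\<^sub>m Suc j) $$ (a, b))"
    unfolding Suc_eq_plus1[symmetric]
  proof (rule homogeneous.cong)
    fix M assume "M \<in> unitary_group n"
    then have "M ^\<^sub>m j \<in> carrier_mat n n" "M \<in> carrier_mat n n" by (auto dest: unitary_carrier)
    from mult_mat_entry[OF this assms(1) Suc.prems]
    show "(\<Sum>e<n. (M ^\<^sub>m j) $$ (a, e) * monomial [(e, b)] M) = (M ^\<^sub>m Suc j) $$ (a, b)" by simp
  qed
  then show ?case by blast
qed

lemma homogeneous_power_trace: "\<exists>c. homogeneous n j c (power_trace j)"
proof -
  have "\<forall>a. \<exists>c. a < n \<longrightarrow> homogeneous n j c (\<lambda>M. (M ^\<^sub>m j) $$ (a, a))"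
    using homogeneous_pow_entry by blast
  from choice[OF this]
  obtain c where c: "\<And>a. a < n \<Longrightarrow> homogeneous n j (c a) (\<lambda>M. (M ^\<^sub>m j) $$ (a, a))" by blast
  have "homogeneous n j (\<Sum>a<n. c a) (\<lambda>M. \<Sum>a<n. (M ^\<^sub>m j) $$ (a, a))"
    by (intro homogeneous_sum c) auto
  then have "homogeneous n j (\<Sum>a<n. c a) (power_trace j)"
    by (rule homogeneous.cong) (simp add: power_trace_eq[OF unitary_carrier])
  then show ?thesis by blast
qed

lemma homogeneous_split_power_trace: "\<exists>c. homogeneous n j c (split_power_trace j)"
proof -
  have "\<forall>l. \<exists>c. homogeneous n l c (power_trace l)" using homogeneous_power_trace by blast
  from choice[OF this]
  obtain c where c: "\<And>l. homogeneous n l (c l) (power_trace l)" by blast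
  have "homogeneous n j (c l * c (j - l)) (\<lambda>M. power_trace l M * power_trace (j - l) M)"
    if "l \<in> {1..<j}" for l
    using homogeneous_mult[OF c[of l] c[of "j - l"]] that by simp
  then have "homogeneous n j (\<Sum>l = 1..<j. c l * c (j - l)) (split_power_trace j)"
    unfolding split_power_trace_def[abs_def] by (intro homogeneous_sum) auto
  then show ?thesis by blast
qed

text \<open>For a log-convex sequence the ratios of consecutive terms increase, so the first ratio is at most
  the asymptotic growth rate.\<close>
lemma log_convex_growth:
  fixes a :: "nat \<Rightarrow> real"
  assumes nn: "\<And>r. a r \<ge> 0" and conv: "\<And>r. (a (Suc r))\<^sup>2 \<le> a r * a (Suc (Suc r))"
    and Q: "Q \<ge> 0" and bound: "\<And>r. a (Suc r) \<le> B * Q ^ r"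
  shows "a 1 \<le> Q * a 0"
proof (rule ccontr)
  assume "\<not> a 1 \<le> Q * a 0"
  then have gt: "Q * a 0 < a 1" by simp
  have a1: "a 1 > 0" using mult_nonneg_nonneg[OF Q nn[of 0]] gt by linarith
  have a0: "a 0 > 0"
  proof (rule ccontr)
    assume "\<not> a 0 > 0"
    then have "a 0 = 0" using nn[of 0] by simp
    then show False using conv[of 0] a1 by simp
  qed
  \<comment> \<open>If the first ratio exceeded \<open>Q\<close>, the sequence would outgrow \<open>B * Q ^ r\<close>.\<close>
  define \<rho> where "\<rho> = a 1 / a 0"
  have \<rho>: "\<rho> > Q" using gt a0 by (simp add: \<rho>_def field_simps)
  have step: "a r > 0 \<and> a (Suc r) \<ge> \<rho> * a r" for r
  proof (induction r)
    case 0
    then show ?case using a0 by (simp add: \<rho>_def)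
  next
    case (Suc r)
    have pos: "a (Suc r) > 0"
      using Suc mult_pos_pos[of \<rho> "a r"] \<rho> Q by linarith
    have "\<rho> * a (Suc r) * a r \<le> a (Suc r) * a (Suc r)"
      using Suc pos by (simp add: mult.commute mult.left_commute)
    also have "\<dots> \<le> a (Suc (Suc r)) * a r" using conv[of r] by (simp add: power2_eq_square mult.commute)
    finally have "\<rho> * a (Suc r) \<le> a (Suc (Suc r))" using Suc by simp
    with pos show ?case by simp
  qed
  have grow: "a (Suc r) \<ge> \<rho> ^ r * a 1" for r
  proof (induction r)
    case (Suc r)
    have "\<rho> ^ Suc r * a 1 \<le> \<rho> * a (Suc r)"
      using Suc \<rho> Q by (simp add: mult.assoc mult_left_mono)
    also have "\<dots> \<le> a (Suc (Suc r))" using step[of "Suc r"] by simp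
    finally show ?case .
  qed simp
  show False
  proof (cases "Q = 0")
    case True
    then have "\<rho> * a 1 \<le> 0" using grow[of 1] bound[of 1] by simp
    then show False using mult_pos_pos[OF _ a1, of \<rho>] \<rho> Q by linarith
  next
    case False
    then have "Q > 0" using Q by simp
    obtain r where r: "B / a 1 < (\<rho> / Q) ^ r"
      using real_arch_pow[of "\<rho> / Q" "B / a 1"] \<rho> \<open>Q > 0\<close> by (auto simp: field_simps)
    then have "B * Q ^ r < \<rho> ^ r * a 1"
      using a1 \<open>Q > 0\<close> by (simp add: field_simps power_divide)
    then show False using grow[of r] bound[of r] by simp
  qed
qed

section \<open>Spectral bound and second moments of power traces\<close>

lemma quadratic_nonneg_discriminant:
  fixes A B c :: real
  assumes "A \<ge> 0" "\<And>t. 0 \<le> A * t\<^sup>2 - 2 * c * t + B"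
  shows "c\<^sup>2 \<le> A * B"
proof (cases "A = 0")
  case True
  have "c = 0"
  proof (rule ccontr)
    assume "c \<noteq> 0"
    then show False using assms(2)[of "(B + 1) / (2 * c)"] True by simp
  qed
  then show ?thesis using True by simp
next
  case False
  then have "A > 0" using assms(1) by simp
  then have "0 \<le> A * (A * (c / A)\<^sup>2 - 2 * c * (c / A) + B)"
    using assms(2)[of "c / A"] by simp
  also have "\<dots> = A * B - c\<^sup>2"
    using \<open>A > 0\<close> by (simp add: field_simps power2_eq_square)
  finally show ?thesis by simp
qed

context haar_unitary
begin

text \<open>The squared \<open>L\<^sup>2\<close> norm with respect to Haar measure.\<close>
definition second_moment :: "(complex mat \<Rightarrow> complex) \<Rightarrow> real" where
  "second_moment F = expectation (\<lambda>M. (norm (F M))\<^sup>2)"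

lemma integrable_norm_product:
  assumes "regular n F" "regular n G"
  shows "integrable \<mu> (\<lambda>M. norm (F M) * norm (G M))"
  using integrable_norm[OF regular_integrable[OF regular_mult[OF assms]]] by (simp add: norm_mult)

lemma integrable_norm_sq: "regular n F \<Longrightarrow> integrable \<mu> (\<lambda>M. (norm (F M))\<^sup>2)"
  using integrable_norm_product[of F F] by (simp add: power2_eq_square)

lemma second_moment_nonneg: "second_moment F \<ge> 0"
  unfolding second_moment_def by (rule integral_nonneg_AE) simp

lemma expectation_norm_sq:
  "expectation (\<lambda>M. F M * cnj (F M)) = complex_of_real (second_moment F)"
  unfolding second_moment_def by (simp only: complex_norm_square[symmetric] integral_complex_of_real)

lemma cauchy_schwarz_norms:
  assumes "regular n F" "regular n G"
  shows "(expectation (\<lambda>M. norm (F M) * norm (G M)))\<^sup>2 \<le> second_moment F * second_moment G"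
proof (rule quadratic_nonneg_discriminant[OF second_moment_nonneg])
  fix t :: real
  note int = integrable_norm_sq[OF assms(1)] integrable_norm_sq[OF assms(2)] integrable_norm_product[OF assms]
  have "0 \<le> expectation (\<lambda>M. (t * norm (F M) - norm (G M))\<^sup>2)"
    by (rule integral_nonneg_AE) simp
  also have "\<dots> = expectation (\<lambda>M. t\<^sup>2 * (norm (F M))\<^sup>2 - 2 * t * (norm (F M) * norm (G M)) + (norm (G M))\<^sup>2)"
    by (rule Bochner_Integration.integral_cong) (simp_all add: power2_eq_square algebra_simps)
  also have "\<dots> = second_moment F * t\<^sup>2 - 2 * expectation (\<lambda>M. norm (F M) * norm (G M)) * t + second_moment G"
    unfolding second_moment_def using int by simp
  finally show "0 \<le> second_moment F * t\<^sup>2 - 2 * expectation (\<lambda>M. norm (F M) * norm (G M)) * t + second_moment G" .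
qed

lemma cauchy_schwarz_inner:
  assumes "regular n F" "regular n G"
  shows "(norm (expectation (\<lambda>M. F M * cnj (G M))))\<^sup>2 \<le> second_moment F * second_moment G"
proof -
  have "norm (expectation (\<lambda>M. F M * cnj (G M))) \<le> expectation (\<lambda>M. norm (F M) * norm (G M))"
    using integral_norm_bound[of \<mu> "\<lambda>M. F M * cnj (G M)"] by (simp add: norm_mult)
  then show ?thesis
    using cauchy_schwarz_norms[OF assms] by (meson norm_ge_zero order_trans power_mono)
qed

lemma expectation_norm_le:
  assumes "regular n F"
  shows "expectation (\<lambda>M. norm (F M)) \<le> sqrt (second_moment F)"
  using cauchy_schwarz_norms[OF assms regular_const[of n 1]]
  by (intro real_le_rsqrt) (simp add: second_moment_def)

text \<open>Integration by parts in the direction \<open>E\<^sub>b\<^sub>a\<close> moves the outer derivative of \<open>D\<^sub>b\<^sub>a D\<^sub>a\<^sub>b F\<close> to the other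
  factor.  The resulting form is Hermitian, which makes the Laplacian symmetric.\<close>
lemma laplacian_inner_gradients:
  assumes F: "has_gradient n F G" "\<And>a b. a < n \<Longrightarrow> b < n \<Longrightarrow> has_gradient n (G a b) (H a b)"
    and L: "\<And>M. M \<in> unitary_group n \<Longrightarrow> L M = (\<Sum>a<n. \<Sum>b<n. H a b b a M)"
    and F': "has_gradient n F' G'"
  shows "expectation (\<lambda>M. L M * cnj (F' M)) = expectation (\<lambda>M. \<Sum>a<n. \<Sum>b<n. G a b M * cnj (G' a b M))"
proof -
  define Q where "Q = (\<lambda>a b M. H a b b a M * cnj (F' M) + G a b M * - cnj (G' a b M))"
  have grad: "has_gradient n (\<lambda>M. G a b M * cnj (F' M))
      (\<lambda>a' b' M. H a b a' b' M * cnj (F' M) + G a b M * - cnj (G' b' a' M))" if "a < n" "b < n" for a b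
    using that by (intro has_gradient_mult has_gradient_cnj F F')
  have Q0: "expectation (Q a b) = 0" and Qr: "regular n (Q a b)" if "a < n" "b < n" for a b
    unfolding Q_def
    using integration_by_parts[OF grad[OF that] that(2,1)] has_gradient_regular'[OF grad[OF that] that(2,1)] .
  have "expectation (\<lambda>M. \<Sum>a<n. \<Sum>b<n. Q a b M) = (\<Sum>a<n. expectation (\<lambda>M. \<Sum>b<n. Q a b M))"
    by (rule Bochner_Integration.integral_sum) (intro regular_integrable regular_sum Qr; simp)
  also have "\<dots> = (\<Sum>a<n. \<Sum>b<n. expectation (Q a b))"
    by (intro sum.cong refl Bochner_Integration.integral_sum) (intro regular_integrable Qr; simp)
  also have "\<dots> = 0" by (simp add: Q0)
  finally have "0 = expectation (\<lambda>M. \<Sum>a<n. \<Sum>b<n. Q a b M)" by simp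
  also have "\<dots> = expectation (\<lambda>M. L M * cnj (F' M) - (\<Sum>a<n. \<Sum>b<n. G a b M * cnj (G' a b M)))"
    by (rule Bochner_Integration.integral_cong[OF refl])
      (simp add: Q_def L sum_subtractf sum_distrib_right)
  also have "\<dots> = expectation (\<lambda>M. L M * cnj (F' M))
      - expectation (\<lambda>M. \<Sum>a<n. \<Sum>b<n. G a b M * cnj (G' a b M))"
  proof (rule Bochner_Integration.integral_diff)
    have "has_laplacian n F L" using F L by (rule has_laplacianI)
    then have "regular n L" by (rule has_laplacian_regular)
    then show "integrable \<mu> (\<lambda>M. L M * cnj (F' M))"
      by (intro regular_integrable regular_mult regular_cnj has_gradient_regular[OF F'])
    show "integrable \<mu> (\<lambda>M. \<Sum>a<n. \<Sum>b<n. G a b M * cnj (G' a b M))"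
      by (intro regular_integrable regular_sum regular_mult regular_cnj
          has_gradient_regular'[OF F(1)] has_gradient_regular'[OF F']) auto
  qed
  finally show ?thesis by simp
qed

lemma laplacian_symmetric:
  assumes "has_laplacian n F L" "has_laplacian n F' L'"
  shows "expectation (\<lambda>M. L M * cnj (F' M)) = expectation (\<lambda>M. F M * cnj (L' M))"
proof -
  obtain G H where GH: "has_gradient n F G" "\<And>a b. a < n \<Longrightarrow> b < n \<Longrightarrow> has_gradient n (G a b) (H a b)"
    and L: "\<And>M. M \<in> unitary_group n \<Longrightarrow> L M = (\<Sum>a<n. \<Sum>b<n. H a b b a M)"
    using has_laplacianE[OF assms(1)] by blast
  obtain G' H' where GH': "has_gradient n F' G'" "\<And>a b. a < n \<Longrightarrow> b < n \<Longrightarrow> has_gradient n (G' a b) (H' a b)"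
    and L': "\<And>M. M \<in> unitary_group n \<Longrightarrow> L' M = (\<Sum>a<n. \<Sum>b<n. H' a b b a M)"
    using has_laplacianE[OF assms(2)] by blast
  have "expectation (\<lambda>M. F M * cnj (L' M)) = cnj (expectation (\<lambda>M. L' M * cnj (F M)))"
    by (subst Bochner_Integration.integral_cnj[symmetric]) (simp add: mult.commute)
  also have "\<dots> = cnj (expectation (\<lambda>M. \<Sum>a<n. \<Sum>b<n. G' a b M * cnj (G a b M)))"
    using laplacian_inner_gradients[OF GH' L' GH(1)] by simp
  also have "\<dots> = expectation (\<lambda>M. \<Sum>a<n. \<Sum>b<n. G a b M * cnj (G' a b M))"
    by (subst Bochner_Integration.integral_cnj[symmetric]) (simp add: mult.commute)
  also have "\<dots> = expectation (\<lambda>M. L M * cnj (F' M))"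
    using laplacian_inner_gradients[OF GH L GH'(1)] by simp
  finally show ?thesis by simp
qed

lemma shifted_laplacian_symmetric:
  assumes F: "has_laplacian n F (\<lambda>M. of_nat \<kappa> * F M + K M)" and K: "regular n K"
    and F': "has_laplacian n F' (\<lambda>M. of_nat \<kappa> * F' M + K' M)" and K': "regular n K'"
  shows "expectation (\<lambda>M. K M * cnj (F' M)) = expectation (\<lambda>M. F M * cnj (K' M))"
proof -
  have rF: "regular n F" "regular n F'" using has_laplacian_regular(1) F F' by auto
  have int: "integrable \<mu> (\<lambda>M. F M * cnj (F' M))" "integrable \<mu> (\<lambda>M. K M * cnj (F' M))"
    "integrable \<mu> (\<lambda>M. F M * cnj (K' M))"
    by (intro regular_integrable regular_mult regular_cnj rF K K')+
  have "of_nat \<kappa> * expectation (\<lambda>M. F M * cnj (F' M)) + expectation (\<lambda>M. K M * cnj (F' M)) =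
      expectation (\<lambda>M. (of_nat \<kappa> * F M + K M) * cnj (F' M))"
    using int by (simp add: distrib_right mult.assoc)
  also have "\<dots> = expectation (\<lambda>M. F M * cnj (of_nat \<kappa> * F' M + K' M))"
    by (rule laplacian_symmetric[OF F F'])
  also have "\<dots> = expectation (\<lambda>M. of_nat \<kappa> * (F M * cnj (F' M)) + F M * cnj (K' M))"
    by (simp add: distrib_left mult.left_commute)
  also have "\<dots> = of_nat \<kappa> * expectation (\<lambda>M. F M * cnj (F' M)) + expectation (\<lambda>M. F M * cnj (K' M))"
    using int by simp
  finally show ?thesis by simp
qed

text \<open>The squared norms of the iterates of a symmetric operator are log-convex by the Cauchy-Schwarz
  inequality, and the supremum norms of these iterates grow at most like powers of \<open>k(k-1)\<close>.  The
  \<open>L\<^sup>2\<close> norm therefore increases by at most this factor at the first step, whatever the size of the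
  coefficients from which the growth starts.\<close>
theorem shifted_laplacian_norm_bound:
  assumes F: "has_laplacian n F (\<lambda>M. of_nat (n * k) * F M + K M)" and K: "homogeneous n k c K"
  shows "second_moment K \<le> (real (k * (k - 1)))\<^sup>2 * second_moment F"
proof -
  define q where "q = real (k * (k - 1))"
  \<comment> \<open>\<open>S r\<close> is the \<open>r\<close>-th iterate on \<open>K\<close>; the sequence \<open>T\<close> puts \<open>F\<close> in front.  Only the iterates from
    \<open>K\<close> on come with coefficient bounds.\<close>
  define P where "P = (\<lambda>r S. homogeneous n k (q ^ r * c) S \<and> (r = 0 \<longrightarrow> S = K))"
  have "\<exists>S. \<forall>r. P r (S r) \<and> has_laplacian n (S r) (\<lambda>M. of_nat (n * k) * S r M + S (Suc r) M)"
  proof (rule dependent_nat_choice)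
    show "\<exists>S. P 0 S" using K by (auto simp: P_def)
  next
    fix S r assume "P r S"
    then have "homogeneous n k (q ^ r * c) S" by (simp add: P_def)
    from homogeneous_laplacian[OF this]
    show "\<exists>S'. P (Suc r) S' \<and> has_laplacian n S (\<lambda>M. of_nat (n * k) * S M + S' M)"
      by (auto simp: P_def q_def mult.assoc)
  qed
  then obtain S where S: "\<And>r. P r (S r)"
    and SL: "\<And>r. has_laplacian n (S r) (\<lambda>M. of_nat (n * k) * S r M + S (Suc r) M)" by blast
  have S0: "S 0 = K" using S[of 0] by (simp add: P_def)
  have Sh: "homogeneous n k (q ^ r * c) (S r)" for r using S[of r] by (simp add: P_def)
  define T where "T = (\<lambda>r. case r of 0 \<Rightarrow> F | Suc r \<Rightarrow> S r)"
  have TL: "has_laplacian n (T r) (\<lambda>M. of_nat (n * k) * T r M + T (Suc r) M)" for r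
    using SL F S0 by (cases r) (simp_all add: T_def)
  have Tr: "regular n (T r)" for r using has_laplacian_regular(1)[OF TL] .
  have "second_moment (T 1) \<le> q\<^sup>2 * second_moment (T 0)"
  proof (rule log_convex_growth)
    show "second_moment (T r) \<ge> 0" for r by (rule second_moment_nonneg)
    show "(second_moment (T (Suc r)))\<^sup>2 \<le> second_moment (T r) * second_moment (T (Suc (Suc r)))" for r
    proof -
      have "complex_of_real (second_moment (T (Suc r))) = expectation (\<lambda>M. T (Suc r) M * cnj (T (Suc r) M))"
        by (rule expectation_norm_sq[symmetric])
      also have "\<dots> = expectation (\<lambda>M. T r M * cnj (T (Suc (Suc r)) M))"
        by (rule shifted_laplacian_symmetric[OF TL Tr TL Tr])
      finally have "expectation (\<lambda>M. T r M * cnj (T (Suc (Suc r)) M)) =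
          complex_of_real (second_moment (T (Suc r)))" by simp
      with cauchy_schwarz_inner[OF Tr Tr, of r "Suc (Suc r)"] show ?thesis
        by (simp only: norm_of_real power2_abs)
    qed
    show "second_moment (T (Suc r)) \<le> c\<^sup>2 * (q\<^sup>2) ^ r" for r
    proof -
      have "second_moment (T (Suc r)) \<le> expectation (\<lambda>M. c\<^sup>2 * (q\<^sup>2) ^ r)"
        unfolding second_moment_def
      proof (rule integral_mono)
        fix M assume "M \<in> space \<mu>"
        then have "norm (T (Suc r) M) \<le> q ^ r * c"
          using homogeneous_bound[OF Sh] by (simp add: T_def)
        then have "(norm (T (Suc r) M))\<^sup>2 \<le> (q ^ r * c)\<^sup>2" by (rule power_mono) simp
        also have "\<dots> = c\<^sup>2 * (q\<^sup>2) ^ r" by (simp add: power_mult_distrib power_mult[symmetric] mult.commute)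
        finally show "(norm (T (Suc r) M))\<^sup>2 \<le> c\<^sup>2 * (q\<^sup>2) ^ r" .
      qed (auto intro: integrable_norm_sq Tr)
      then show ?thesis by simp
    qed
  qed simp
  then show ?thesis by (simp add: T_def S0 q_def)
qed

text \<open>On \<open>p\<^sub>j\<close> the shifted Laplacian takes the value \<open>j S\<^sub>j\<close>, and \<open>j(j-1)\<close> bounds its norm.\<close>
lemma second_moment_split_power_trace:
  assumes "j \<ge> 1"
  shows "second_moment (split_power_trace j) \<le> (real (j - 1))\<^sup>2 * second_moment (power_trace j)"
proof -
  obtain c where "homogeneous n j c (split_power_trace j)" using homogeneous_split_power_trace by blast
  then have "homogeneous n j (norm (of_nat j :: complex) * c) (\<lambda>M. of_nat j * split_power_trace j M)"
    by (rule homogeneous.scale)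
  then have "second_moment (\<lambda>M. of_nat j * split_power_trace j M) \<le>
      (real (j * (j - 1)))\<^sup>2 * second_moment (power_trace j)"
    by (rule shifted_laplacian_norm_bound[OF has_laplacian_power_trace[OF assms]])
  moreover have "second_moment (\<lambda>M. of_nat j * split_power_trace j M) =
      (real j)\<^sup>2 * second_moment (split_power_trace j)"
    by (simp add: second_moment_def norm_mult power_mult_distrib)
  ultimately have "(real j)\<^sup>2 * second_moment (split_power_trace j) \<le>
      (real j)\<^sup>2 * ((real (j - 1))\<^sup>2 * second_moment (power_trace j))"
    by (simp only: of_nat_mult power_mult_distrib mult.assoc)
  then show ?thesis using assms by simp
qed

text \<open>With \<open>m = E|p\<^sub>j|\<^sup>2\<close>, the second moment identity and the bound on \<open>S\<^sub>j\<close> give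
  \<open>n m \<le> jn + (j-1) m\<close>, and \<open>j - 1 \<le> n / 2\<close>.  The true value is \<open>j\<close>.\<close>
lemma second_moment_power_trace:
  assumes "j \<ge> 1" "2 * j \<le> n"
  shows "second_moment (power_trace j) \<le> 2 * real j"
proof -
  define m where "m = second_moment (power_trace j)"
  define z where "z = expectation (\<lambda>M. split_power_trace j M * cnj (power_trace j M))"
  have m0: "m \<ge> 0" unfolding m_def by (rule second_moment_nonneg)
  have reg: "regular n (power_trace j)" "regular n (split_power_trace j)"
    by (rule regular_power_trace regular_split_power_trace)+
  have int: "integrable \<mu> (\<lambda>M. power_trace j M * cnj (power_trace j M))"
    "integrable \<mu> (\<lambda>M. split_power_trace j M * cnj (power_trace j M))"
    by (intro regular_integrable regular_mult regular_cnj reg)+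
  have "complex_of_real (real (j * n)) =
      expectation (\<lambda>M. (of_nat n * power_trace j M + split_power_trace j M) * cnj (power_trace j M))"
    using power_trace_second_moment_identity[OF assms(1)] by simp
  also have "\<dots> = of_nat n * complex_of_real m + z"
    unfolding m_def z_def expectation_norm_sq[symmetric]
    using int by (simp add: distrib_right mult.assoc)
  finally have "complex_of_real (real (j * n) - real n * m) = z" by simp
  then have "norm z = \<bar>real (j * n) - real n * m\<bar>" by (metis norm_of_real)
  moreover have "norm z \<le> real (j - 1) * m"
  proof -
    have "(norm z)\<^sup>2 \<le> second_moment (split_power_trace j) * m"
      unfolding z_def m_def by (rule cauchy_schwarz_inner[OF reg(2,1)])
    also have "\<dots> \<le> (real (j - 1))\<^sup>2 * m * m"
      using second_moment_split_power_trace[OF assms(1)] m0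
      unfolding m_def by (intro mult_right_mono) auto
    also have "\<dots> = (real (j - 1) * m)\<^sup>2" by (simp add: power2_eq_square mult_ac)
    finally show ?thesis by (rule power2_le_imp_le) (simp add: m0)
  qed
  ultimately have "real n * m \<le> real (j * n) + real (j - 1) * m" by linarith
  moreover have "real (j - 1) * m \<le> (real n / 2) * m"
    using assms m0 by (intro mult_right_mono) auto
  ultimately have "real n * m \<le> 2 * real (j * n)" by (simp add: field_simps)
  also have "\<dots> = real n * (2 * real j)" by simp
  finally show ?thesis using assms unfolding m_def by (simp del: of_nat_mult)
qed

end

section \<open>Normal approximation of the trace statistic\<close>

context haar_unitary
begin

lemma trace_power_stat_eq:
  "complex_of_real (trace_power_stat j M) =
     complex_of_real (1 / sqrt (2 * real j)) * (power_trace j M + cnj (power_trace j M))"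
  by (simp add: trace_power_stat_def power_trace_def complex_add_cnj)

lemma has_gradient_trace_power_stat:
  "has_gradient n (\<lambda>M. complex_of_real (trace_power_stat j M))
     (\<lambda>a b M. complex_of_real (1 / sqrt (2 * real j)) *
       (of_nat j * (M ^\<^sub>m j) $$ (b, a) + - cnj (of_nat j * (M ^\<^sub>m j) $$ (a, b))))"
  unfolding trace_power_stat_eq
  by (intro has_gradient_cmult has_gradient_add has_gradient_power_trace has_gradient_cnj)

text \<open>The Schwinger-Dyson equation for \<open>f(W)\<close>.  The gradient of \<open>W\<close> contracts with \<open>M^j\<close> to
  \<open>j (p\<^sub>2\<^sub>j - n) / sqrt(2j)\<close>: the constant part produces \<open>E[f'(W)]\<close> with exactly the normalisation of
  \<open>W\<close>, while \<open>p\<^sub>2\<^sub>j\<close> and \<open>S\<^sub>j\<close> are the errors.\<close>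
lemma stein_identity_defect:
  assumes j: "j \<ge> 1"
    and f: "\<And>w. (f has_real_derivative f' w) (at w)" "continuous_on UNIV f'"
      "\<And>w. \<bar>f w\<bar> \<le> 6" "\<And>w. \<bar>f' w\<bar> \<le> 2"
  shows "real n * expectation (\<lambda>M. f' (trace_power_stat j M) - trace_power_stat j M * f (trace_power_stat j M)) =
    expectation (\<lambda>M. f' (trace_power_stat j M) * Re (power_trace (2 * j) M)
      + 2 / sqrt (2 * real j) * (f (trace_power_stat j M) * Re (split_power_trace j M)))"
proof -
  define W where "W = trace_power_stat j"
  define \<sigma> where "\<sigma> = 1 / sqrt (2 * real j)"
  have \<sigma>: "2 * \<sigma> * \<sigma> * real j = 1"
    using j by (simp add: \<sigma>_def)
  \<comment> \<open>The integrand of the Schwinger-Dyson equation; \<open>2 \<sigma> Re Z\<close> compares with \<open>W f(W) - f'(W)\<close> pointwise.\<close>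
  define Z where "Z = (\<lambda>M. (of_nat n * power_trace j M + split_power_trace j M) * complex_of_real (f (W M))
     + complex_of_real (f' (W M)) * (complex_of_real \<sigma> * (of_nat j * (power_trace (2 * j) M - of_nat n))))"
  have gradW: "has_gradient n (\<lambda>M. complex_of_real (W M))
     (\<lambda>a b M. complex_of_real \<sigma> *
       (of_nat j * (M ^\<^sub>m j) $$ (b, a) + - cnj (of_nat j * (M ^\<^sub>m j) $$ (a, b))))"
    unfolding W_def \<sigma>_def by (rule has_gradient_trace_power_stat)
  have gradf: "has_gradient n (\<lambda>M. complex_of_real (f (W M)))
     (\<lambda>a b M. complex_of_real (f' (W M)) * (complex_of_real \<sigma> *
       (of_nat j * (M ^\<^sub>m j) $$ (b, a) + - cnj (of_nat j * (M ^\<^sub>m j) $$ (a, b)))))"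
    by (rule has_gradient_of_real_compose[OF gradW f])
  have regW: "regular n (\<lambda>M. complex_of_real (W M))" by (rule has_gradient_regular[OF gradW])
  have regf: "regular n (\<lambda>M. complex_of_real (f (W M)))" by (rule has_gradient_regular[OF gradf])
  have regf': "regular n (\<lambda>M. complex_of_real (f' (W M)))"
    by (rule regular_of_real_compose[OF regW f(2,4)])
  have reg1: "regular n (\<lambda>M. (of_nat n * power_trace j M + split_power_trace j M) * complex_of_real (f (W M)))"
    by (intro regular_mult regular_add regular_const regular_power_trace regular_split_power_trace regf)
  have reg2: "regular n (\<lambda>M. complex_of_real (f' (W M)) *
      (complex_of_real \<sigma> * (of_nat j * (power_trace (2 * j) M + - of_nat n))))"
    by (intro regular_mult regular_add regular_const regular_power_trace regf')
  have "expectation (\<lambda>M. \<Sum>a<n. \<Sum>b<n. (M ^\<^sub>m j) $$ (a, b) * (complex_of_real (f' (W M)) * (complex_of_real \<sigma> *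
       (of_nat j * (M ^\<^sub>m j) $$ (b, a) + - cnj (of_nat j * (M ^\<^sub>m j) $$ (a, b)))))) =
    expectation (\<lambda>M. complex_of_real (f' (W M)) *
      (complex_of_real \<sigma> * (of_nat j * (power_trace (2 * j) M + - of_nat n))))"
  proof (rule Bochner_Integration.integral_cong[OF refl])
    fix M assume "M \<in> space \<mu>"
    then have M: "M \<in> unitary_group n" by simp
    have "(\<Sum>a<n. \<Sum>b<n. (M ^\<^sub>m j) $$ (a, b) * (M ^\<^sub>m j) $$ (b, a)) = (\<Sum>a<n. (M ^\<^sub>m (j + j)) $$ (a, a))"
      by (intro sum.cong refl pow_contraction[OF unitary_carrier[OF M]]) auto
    then have 1: "(\<Sum>a<n. \<Sum>b<n. (M ^\<^sub>m j) $$ (a, b) * (M ^\<^sub>m j) $$ (b, a)) = power_trace (2 * j) M"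
      by (simp add: power_trace_eq[OF unitary_carrier[OF M]] mult_2)
    have 2: "(\<Sum>a<n. \<Sum>b<n. (M ^\<^sub>m j) $$ (a, b) * cnj ((M ^\<^sub>m j) $$ (a, b))) = of_nat n"
      using unitary_row_norm[OF unitary_pow[OF M]] by simp
    have "(\<Sum>a<n. \<Sum>b<n. (M ^\<^sub>m j) $$ (a, b) * (complex_of_real (f' (W M)) * (complex_of_real \<sigma> *
       (of_nat j * (M ^\<^sub>m j) $$ (b, a) + - cnj (of_nat j * (M ^\<^sub>m j) $$ (a, b)))))) =
      (\<Sum>a<n. \<Sum>b<n. complex_of_real (f' (W M)) * (complex_of_real \<sigma> * (of_nat j *
       ((M ^\<^sub>m j) $$ (a, b) * (M ^\<^sub>m j) $$ (b, a) - (M ^\<^sub>m j) $$ (a, b) * cnj ((M ^\<^sub>m j) $$ (a, b))))))"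
      by (intro sum.cong refl) (simp add: algebra_simps)
    also have "\<dots> = complex_of_real (f' (W M)) * (complex_of_real \<sigma> * (of_nat j * (power_trace (2 * j) M + - of_nat n)))"
      unfolding sum_distrib_left[symmetric] sum_subtractf 1 2 by simp
    finally show "(\<Sum>a<n. \<Sum>b<n. (M ^\<^sub>m j) $$ (a, b) * (complex_of_real (f' (W M)) * (complex_of_real \<sigma> *
       (of_nat j * (M ^\<^sub>m j) $$ (b, a) + - cnj (of_nat j * (M ^\<^sub>m j) $$ (a, b)))))) =
      complex_of_real (f' (W M)) * (complex_of_real \<sigma> * (of_nat j * (power_trace (2 * j) M + - of_nat n)))" .
  qed
  then have "expectation (\<lambda>M. (of_nat n * power_trace j M + split_power_trace j M) * complex_of_real (f (W M)))
     + expectation (\<lambda>M. complex_of_real (f' (W M)) *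
      (complex_of_real \<sigma> * (of_nat j * (power_trace (2 * j) M + - of_nat n)))) = 0"
    using schwinger_dyson[OF gradf j] by (simp only:)
  then have Z0: "expectation Z = 0"
    using regular_integrable[OF reg1] regular_integrable[OF reg2] by (simp add: Z_def)
  have "regular n Z" using regular_add[OF reg1 reg2] by (simp add: Z_def)
  then have intZ: "integrable \<mu> Z" by (rule regular_integrable)
  have pointwise: "real n * (f' (W M) - W M * f (W M)) =
      (f' (W M) * Re (power_trace (2 * j) M) + 2 * \<sigma> * (f (W M) * Re (split_power_trace j M)))
      - 2 * \<sigma> * Re (Z M)" for M
  proof -
    have "W M = 2 * \<sigma> * Re (power_trace j M)"
      by (simp add: W_def \<sigma>_def trace_power_stat_def power_trace_def complex_add_cnj)
    then have "2 * \<sigma> * Re (Z M) = real n * (W M * f (W M)) + 2 * \<sigma> * (f (W M) * Re (split_power_trace j M))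
       + (2 * \<sigma> * \<sigma> * real j) * (f' (W M) * (Re (power_trace (2 * j) M) - real n))"
      by (simp add: Z_def algebra_simps)
    then show ?thesis unfolding \<sigma> by (simp add: algebra_simps)
  qed
  define E where "E = (\<lambda>M. f' (W M) * Re (power_trace (2 * j) M) + 2 * \<sigma> * (f (W M) * Re (split_power_trace j M)))"
  have intE: "integrable \<mu> E"
  proof -
    have "regular n (\<lambda>M. complex_of_real (f' (W M)) * power_trace (2 * j) M
        + complex_of_real (2 * \<sigma>) * (complex_of_real (f (W M)) * split_power_trace j M))"
      by (intro regular_add regular_mult regular_const regf regf' regular_power_trace regular_split_power_trace)
    from integrable_Re[OF regular_integrable[OF this]] show ?thesis by (simp add: E_def)
  qed
  have "real n * expectation (\<lambda>M. f' (W M) - W M * f (W M)) =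
      expectation (\<lambda>M. real n * (f' (W M) - W M * f (W M)))" by simp
  also have "\<dots> = expectation (\<lambda>M. E M - 2 * \<sigma> * Re (Z M))"
    unfolding pointwise E_def ..
  also have "\<dots> = expectation E - 2 * \<sigma> * expectation (\<lambda>M. Re (Z M))"
    using intE integrable_Re[OF intZ] by simp
  also have "expectation (\<lambda>M. Re (Z M)) = 0"
    using integral_Re[OF intZ] Z0 by simp
  finally show ?thesis by (simp add: E_def W_def \<sigma>_def)
qed

text \<open>The term with \<open>p\<^sub>2\<^sub>j\<close> contributes \<open>2 * 2j\<close>, since \<open>\<bar>f'\<bar> \<le> 2\<close> and \<open>E|p\<^sub>2\<^sub>j| \<le> 2j\<close>.  The term with \<open>S\<^sub>j\<close>
  contributes \<open>(2 / sqrt(2j)) * 6 * j sqrt(2j) = 12j\<close>, since \<open>\<bar>f\<bar> \<le> 6\<close> and \<open>E|S\<^sub>j| \<le> j sqrt(2j)\<close>.\<close>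
lemma stein_identity_defect_bound:
  assumes j: "j \<ge> 1" "4 * j \<le> n"
    and f: "\<And>w. (f has_real_derivative f' w) (at w)" "continuous_on UNIV f'"
      "\<And>w. \<bar>f w\<bar> \<le> 6" "\<And>w. \<bar>f' w\<bar> \<le> 2"
  shows "\<bar>expectation (\<lambda>M. f' (trace_power_stat j M) - trace_power_stat j M * f (trace_power_stat j M))\<bar>
    \<le> 16 * real j / real n"
proof -
  define W where "W = trace_power_stat j"
  define s where "s = sqrt (2 * real j)"
  have s: "s > 0" "s * s = 2 * real j" using j by (simp_all add: s_def)
  have int: "integrable \<mu> (\<lambda>M. norm (power_trace (2 * j) M))" "integrable \<mu> (\<lambda>M. norm (split_power_trace j M))"
    by (intro integrable_norm regular_integrable regular_power_trace regular_split_power_trace)+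
  have "expectation (\<lambda>M. norm (power_trace (2 * j) M)) \<le> sqrt (second_moment (power_trace (2 * j)))"
    by (rule expectation_norm_le[OF regular_power_trace])
  also have "\<dots> \<le> sqrt ((2 * real j)\<^sup>2)"
  proof (rule real_sqrt_le_mono)
    have "second_moment (power_trace (2 * j)) \<le> 2 * real (2 * j)"
      using j by (intro second_moment_power_trace) auto
    also have "\<dots> \<le> (2 * real j)\<^sup>2" using j by (simp add: power2_eq_square)
    finally show "second_moment (power_trace (2 * j)) \<le> (2 * real j)\<^sup>2" .
  qed
  also have "\<dots> = 2 * real j" by (subst real_sqrt_abs) simp
  finally have p: "expectation (\<lambda>M. norm (power_trace (2 * j) M)) \<le> 2 * real j" .
  have "expectation (\<lambda>M. norm (split_power_trace j M)) \<le> sqrt (second_moment (split_power_trace j))"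
    by (rule expectation_norm_le[OF regular_split_power_trace])
  also have "\<dots> \<le> sqrt ((real j * s)\<^sup>2)"
  proof (rule real_sqrt_le_mono)
    have "second_moment (split_power_trace j) \<le> (real (j - 1))\<^sup>2 * second_moment (power_trace j)"
      by (rule second_moment_split_power_trace[OF j(1)])
    also have "\<dots> \<le> (real j)\<^sup>2 * (2 * real j)"
      using j by (intro mult_mono second_moment_power_trace power_mono second_moment_nonneg) auto
    also have "\<dots> = (real j * s)\<^sup>2" using s(2) by (simp add: power2_eq_square mult_ac)
    finally show "second_moment (split_power_trace j) \<le> (real j * s)\<^sup>2" .
  qed
  finally have S: "expectation (\<lambda>M. norm (split_power_trace j M)) \<le> real j * s" using s(1) by simp
  have "real n * \<bar>expectation (\<lambda>M. f' (W M) - W M * f (W M))\<bar> =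
      \<bar>real n * expectation (\<lambda>M. f' (W M) - W M * f (W M))\<bar>" by (simp add: abs_mult)
  also have "\<dots> = \<bar>expectation (\<lambda>M. f' (W M) * Re (power_trace (2 * j) M)
      + 2 / s * (f (W M) * Re (split_power_trace j M)))\<bar>"
    using stein_identity_defect[OF j(1) f] by (simp add: W_def s_def)
  also have "\<dots> \<le> expectation (\<lambda>M. 2 * norm (power_trace (2 * j) M) + 2 / s * (6 * norm (split_power_trace j M)))"
  proof -
    have pw: "\<bar>f' (W M) * Re (power_trace (2 * j) M) + 2 / s * (f (W M) * Re (split_power_trace j M))\<bar>
        \<le> 2 * norm (power_trace (2 * j) M) + 2 / s * (6 * norm (split_power_trace j M))" for M
    proof -
      have "\<bar>f' (W M) * Re (power_trace (2 * j) M)\<bar> \<le> 2 * norm (power_trace (2 * j) M)"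
        unfolding abs_mult using f(4) abs_Re_le_cmod by (intro mult_mono) auto
      moreover have "\<bar>f (W M) * Re (split_power_trace j M)\<bar> \<le> 6 * norm (split_power_trace j M)"
        unfolding abs_mult using f(3) abs_Re_le_cmod by (intro mult_mono) auto
      then have "\<bar>2 / s * (f (W M) * Re (split_power_trace j M))\<bar> \<le> 2 / s * (6 * norm (split_power_trace j M))"
        unfolding abs_mult[of "2 / s"] using s(1) by (intro mult_mono) auto
      ultimately show ?thesis by linarith
    qed
    have "\<bar>expectation (\<lambda>M. f' (W M) * Re (power_trace (2 * j) M) + 2 / s * (f (W M) * Re (split_power_trace j M)))\<bar>
       \<le> expectation (\<lambda>M. \<bar>f' (W M) * Re (power_trace (2 * j) M) + 2 / s * (f (W M) * Re (split_power_trace j M))\<bar>)"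
      by (rule integral_abs_bound)
    also have "\<dots> \<le> expectation (\<lambda>M. 2 * norm (power_trace (2 * j) M) + 2 / s * (6 * norm (split_power_trace j M)))"
    proof (rule integral_mono')
      show "0 \<le> 2 * norm (power_trace (2 * j) M) + 2 / s * (6 * norm (split_power_trace j M))" for M
        using order_trans[OF abs_ge_zero pw] .
    qed (use int pw in simp_all)
    finally show ?thesis .
  qed
  also have "\<dots> = 2 * expectation (\<lambda>M. norm (power_trace (2 * j) M))
      + 2 / s * (6 * expectation (\<lambda>M. norm (split_power_trace j M)))"
    using int by simp
  also have "\<dots> \<le> 2 * (2 * real j) + 2 / s * (6 * (real j * s))"
    using p S s(1) by (intro add_mono mult_left_mono) auto
  also have "\<dots> = 16 * real j" using s(1) by simp
  finally show ?thesis
    using j by (simp add: W_def pos_le_divide_eq mult.commute)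
qed

text \<open>The condition \<open>4j \<le> n\<close> is the one under which the second moment bound covers \<open>p\<^sub>2\<^sub>j\<close>.\<close>
lemma kolmogorov_distance:
  assumes "n \<ge> 1" "j \<ge> 1"
  shows "\<bar>prob {M \<in> space \<mu>. trace_power_stat j M \<le> t} - normal_tail (- t)\<bar> \<le> 16 * real j / real n"
proof (cases "4 * j \<le> n")
  case True
  have "(\<lambda>M. Re (complex_of_real (trace_power_stat j M))) \<in> borel_measurable \<mu>"
    by (rule measurable_compose[OF regular_measurable_haar[OF
            has_gradient_regular[OF has_gradient_trace_power_stat]] borel_measurable_Re])
  then have "random_variable borel (trace_power_stat j)" by simp
  then show ?thesis
    by (rule stein_kolmogorov_bound) (rule stein_identity_defect_bound[OF assms(2) True])
next
  case False
  have "0 \<le> normal_tail (- t)"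
    unfolding normal_tail_def by (rule integral_nonneg_AE) (auto simp: indicator_def)
  moreover have "normal_tail (- t) \<le> 1" by (rule normal_tail_le_1)
  moreover have "0 \<le> prob A" "prob A \<le> 1" for A by auto
  ultimately have "\<bar>prob {M \<in> space \<mu>. trace_power_stat j M \<le> t} - normal_tail (- t)\<bar> \<le> 1"
    by (smt (verit))
  also have "1 \<le> 16 * real j / real n" using False assms by (simp add: field_simps)
  finally show ?thesis .
qed

end

theorem theorem5p8:
  shows "\<exists>C::real. C > 0 \<and>
    (\<forall>(n::nat) (j::nat) (\<mu> :: complex mat measure) (x0::real).
       n \<ge> 1 \<longrightarrow> j \<ge> 1 \<longrightarrow> haar_prob_measure n \<mu> \<longrightarrow>
       \<bar>measure \<mu> {M \<in> space \<mu>. trace_power_stat j M \<le> x0}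
         - 1 / sqrt (2 * pi) * (LBINT x:{..x0}. exp (- (x\<^sup>2) / 2))\<bar>
       \<le> C * real j / real n)"
proof (intro exI[of _ 16] conjI allI impI)
  fix n j :: nat and \<mu> :: "complex mat measure" and x0 :: real
  assume n: "n \<ge> 1" and j: "j \<ge> 1" and "haar_prob_measure n \<mu>"
  then interpret haar_unitary n \<mu> by unfold_locales
  show "\<bar>measure \<mu> {M \<in> space \<mu>. trace_power_stat j M \<le> x0}
         - 1 / sqrt (2 * pi) * (LBINT x:{..x0}. exp (- (x\<^sup>2) / 2))\<bar>
       \<le> 16 * real j / real n"
    unfolding normal_cdf_eq by (rule kolmogorov_distance[OF n j])
qed simp

end
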